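(* Let $U$ be a non-empty metric space, let $g:\mathbb{R}^d\times U\to\mathbb{R}^d$ be measurable, with $L\ge0$ such that $\|g(y,u)-g(y',u)\|\le L\|y-y'\|$ for all $y,y'\in\mathbb{R}^d$, $u\in U$, and $a>0$ such that $\|g(y,u)\|\le a(1+\|y\|)$ for all $(y,u)\in\mathbb{R}^d\times U$. Let $h:\mathbb{R}^d\times U\to\mathbb{R}$ be measurable and bounded, and let $y_0\in\mathbb{R}^d$. Assume furthermore: (i) $h(y,u)=h(y)$ only depends on the state, and is continuous on $\mathbb{R}^d$; (ii) the reachable set $G(y_0)$ is bounded; (iii) for all $(y_1,y_2)\in G(y_0)^2$, $\ \sup_{u\in U}\inf_{v\in U}\langle y_1-y_2,\ g(y_1,u)-g(y_2,v)\rangle\le 0$. Then the problem $\Gamma(y_0)$ has a limit value, which is $V^*(y_0)$, i.e. $V_t(y_0)\to V^*(y_0)$ as $t\to+\infty$. The convergence of $(V_t)_t$ to $V^*$ is uniform over $G(y_0)$, and $$V^*(y_0)=\sup_{t\ge1}\inf_{m\ge0}V_{m,t}(y_0)=\inf_{m\ge0}\sup_{t\ge1}V_{m,t}(y_0)=\lim_{m\to\infty,\,t\to\infty}V_{m,t}(y_0).$$ Moreover the value of $\Gamma(y_0)$ is uniform.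
   Context: $\mathcal{U}$ is the set of measurable controls $u:\mathbb{R}_+\to U$. For $z\in\mathbb{R}^d$ and $u\in\mathcal{U}$, $s\mapsto y(s,u,z)$ is the unique absolutely continuous solution on $\mathbb{R}_+$ of $y'(s)=g(y(s),u(s))$ for a.e. $s$, $y(0)=z$. The reachable set is $G(z)=\{y(t,u,z):t\ge0,\ u\in\mathcal{U}\}$. For real $m\ge0$ and $t>0$: $$\gamma_{m,t}(z,u)=\frac1t\int_m^{m+t}h(y(s,u,z),u(s))\,ds,\qquad V_{m,t}(z)=\inf_{u\in\mathcal{U}}\gamma_{m,t}(z,u),$$ $\gamma_t=\gamma_{0,t}$, $V_t=V_{0,t}$, and $V^*(z)=\sup_{t>0}\inf_{m\ge0}V_{m,t}(z)$. The problem $\Gamma(y_0)$ (the family of problems of minimizing $\gamma_t(y_0,\cdot)$ over $\mathcal{U}$, $t>0$) has a limit value if $V(y_0):=\lim_{t\to\infty}V_t(y_0)$ exists. It has a uniform value (its value is uniform) if it has a limit value $V(y_0)$ and for every $\varepsilon>0$ there exist $u\in\mathcal{U}$ and $t_0$ such that for all $t\ge t_0$, $\gamma_t(y_0,u)\le V(y_0)+\varepsilon$. $\langle\cdot,\cdot\rangle$ is the canonical scalar product of $\mathbb{R}^d$ and $\|\cdot\|$ the associated norm. *)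

theory Defs
  imports "HOL-Analysis.Analysis"
begin

definition abs_continuous_on :: "real \<Rightarrow> real \<Rightarrow> (real \<Rightarrow> 'a::metric_space) \<Rightarrow> bool" where
  "abs_continuous_on a b f \<longleftrightarrow>
     (\<forall>\<epsilon>>0. \<exists>\<delta>>0. \<forall>(n::nat) (l::nat \<Rightarrow> real) (r::nat \<Rightarrow> real).
        (\<forall>i<n. a \<le> l i \<and> l i \<le> r i \<and> r i \<le> b) \<and>
        (\<forall>i<n. \<forall>j<n. i \<noteq> j \<longrightarrow> {l i<..<r i} \<inter> {l j<..<r j} = {}) \<and>
        (\<Sum>i<n. r i - l i) < \<delta>
        \<longrightarrow> (\<Sum>i<n. dist (f (l i)) (f (r i))) < \<epsilon>)"

(* Controls are functions on all of the reals; only their restriction to {0..} is ever used. *)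
definition controls :: "(real \<Rightarrow> 'u::metric_space) set" where
  "controls = borel_measurable (lebesgue_on {0..})"

(* Absolute continuity on the half-line is meant on every compact subinterval, as usual for
   Caratheodory solutions: already exp is not absolutely continuous on the whole of {0..}. *)
definition solution ::
  "('a::euclidean_space \<times> 'u::metric_space \<Rightarrow> 'a) \<Rightarrow> (real \<Rightarrow> 'u) \<Rightarrow> 'a \<Rightarrow> (real \<Rightarrow> 'a) \<Rightarrow> bool" where
  "solution g u z y \<longleftrightarrow>
     (\<forall>T\<ge>0. abs_continuous_on 0 T y) \<and>
     (AE s in lebesgue. s \<ge> 0 \<longrightarrow>
        (y has_vector_derivative g (y s, u s)) (at s within {0..})) \<and>
     y 0 = z"

(* The description is taken pointwise in s, since a solution is determined on {0..} only. *)
definition traj ::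
  "('a::euclidean_space \<times> 'u::metric_space \<Rightarrow> 'a) \<Rightarrow> real \<Rightarrow> (real \<Rightarrow> 'u) \<Rightarrow> 'a \<Rightarrow> 'a" where
  "traj g s u z = (THE x. \<exists>y. solution g u z y \<and> y s = x)"

definition reachable ::
  "('a::euclidean_space \<times> 'u::metric_space \<Rightarrow> 'a) \<Rightarrow> 'a \<Rightarrow> 'a set" where
  "reachable g z = {traj g t u z | t u. t \<ge> 0 \<and> u \<in> controls}"

definition avg_cost ::
  "('a::euclidean_space \<times> 'u::metric_space \<Rightarrow> 'a) \<Rightarrow> ('a \<times> 'u \<Rightarrow> real)
    \<Rightarrow> real \<Rightarrow> real \<Rightarrow> 'a \<Rightarrow> (real \<Rightarrow> 'u) \<Rightarrow> real" where
  "avg_cost g h m t z u = (1 / t) * (LINT s:{m..m + t}|lebesgue. h (traj g s u z, u s))"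

definition val ::
  "('a::euclidean_space \<times> 'u::metric_space \<Rightarrow> 'a) \<Rightarrow> ('a \<times> 'u \<Rightarrow> real)
    \<Rightarrow> real \<Rightarrow> real \<Rightarrow> 'a \<Rightarrow> real" where
  "val g h m t z = (INF u\<in>controls. avg_cost g h m t z u)"

definition val_star ::
  "('a::euclidean_space \<times> 'u::metric_space \<Rightarrow> 'a) \<Rightarrow> ('a \<times> 'u \<Rightarrow> real) \<Rightarrow> 'a \<Rightarrow> real" where
  "val_star g h z = (SUP t\<in>{0<..}. INF m\<in>{0..}. val g h m t z)"

definition has_limit_value ::
  "('a::euclidean_space \<times> 'u::metric_space \<Rightarrow> 'a) \<Rightarrow> ('a \<times> 'u \<Rightarrow> real)
    \<Rightarrow> 'a \<Rightarrow> real \<Rightarrow> bool" where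
  "has_limit_value g h z v \<longleftrightarrow> ((\<lambda>t. val g h 0 t z) \<longlongrightarrow> v) at_top"

definition has_uniform_value ::
  "('a::euclidean_space \<times> 'u::metric_space \<Rightarrow> 'a) \<Rightarrow> ('a \<times> 'u \<Rightarrow> real) \<Rightarrow> 'a \<Rightarrow> bool" where
  "has_uniform_value g h z \<longleftrightarrow>
     (\<exists>v. has_limit_value g h z v \<and>
       (\<forall>\<epsilon>>0. \<exists>u\<in>controls. \<exists>t0>0. \<forall>t\<ge>t0. avg_cost g h 0 t z u \<le> v + \<epsilon>))"

end

theory Submission
  imports Defs
begin

text \<open>Condition (iii) decouples: its infimum over \<open>v\<close> does not see \<open>u\<close>, so it only compares
\<open>sup\<^sub>u \<langle>y\<^sub>1 - y\<^sub>2, g(y\<^sub>1, u)\<rangle>\<close> with \<open>sup\<^sub>v \<langle>y\<^sub>1 - y\<^sub>2, g(y\<^sub>2, v)\<rangle>\<close>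
(\<open>dissipativity_decoupled\<close>). Hence one \<^emph>\<open>constant\<close> control, almost maximal in the second supremum,
answers every control of the first trajectory at once, as long as the two states stay near
\<open>y\<^sub>1\<close> and \<open>y\<^sub>2\<close>. On a step of length \<open>l\<close> the squared distance then grows by at most \<open>K l\<^sup>2\<close>; steps
proportional to \<open>1/(n + 1)\<close> cover the whole half-line with an arbitrarily small total error. So every
trajectory issued from the reachable set can be followed from any other reachable state, for all times,
without increasing the distance by more than \<open>\<epsilon>\<close> (\<open>nonexpansive_response\<close>).

What remains is a statement about a family of plays (paths in a totally bounded set \<open>G\<close>) which can be
shifted, concatenated countably often, and followed nonexpansively, with a uniformly continuous running
cost. Following makes all values \<open>V\<^sub>m\<^sub>,\<^sub>t\<close> equicontinuous, and total boundedness implies that whatever can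
be reached at all can be approached within a bounded time \<open>M\<close>, uniformly in the initial state
(\<open>bounded_time_reach\<close>). Since the first \<open>M\<close> units of time have no weight in a long average,
\<open>V\<^sub>t \<le> inf\<^sub>m V\<^sub>m\<^sub>,\<^sub>t + \<epsilon>\<close> for large \<open>t\<close>; conversely, cutting a long horizon into blocks of length \<open>s\<close>
shows that \<open>inf\<^sub>m V\<^sub>m\<^sub>,\<^sub>s\<close> is asymptotically below every long average. The two bounds give
\<open>V\<^sub>t \<rightarrow> V\<^sup>*\<close>, and equicontinuity makes the convergence uniform (\<open>V0_uniform_convergence\<close>).

For the uniform value, a long play with average close to \<open>V\<^sup>*\<close> contains a date from which \<^emph>\<open>all\<close>
averages up to a prescribed horizon are at most \<open>V\<^sup>* + \<epsilon>\<close>, for otherwise greedily chosen expensive blocks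
would fill it. By the previous argument this date may be taken bounded, and a play that is cheap on
\<open>[0, 2n]\<close> cannot have lost more than \<open>4\<epsilon>\<close> of \<open>V\<^sup>*\<close> at date \<open>n\<close> (\<open>cheap_block\<close>). Concatenating such
blocks for \<open>\<epsilon>\<^sub>0, \<epsilon>\<^sub>0/2, \<epsilon>\<^sub>0/4, \<dots>\<close> yields \<open>uniform_value\<close>. Along the resulting play \<open>V\<^sup>*\<close> never exceeds its
initial value by much, which gives the joint limit, and the greedy argument applied to it gives
\<open>inf\<^sub>m sup\<^sub>t V\<^sub>m\<^sub>,\<^sub>t \<le> V\<^sup>*\<close>.

To apply this to the control system, its Caratheodory solutions have to exist, be unique and be
concatenable. All of this is done on the integral equation, where gluing and estimates are immediate. Its
equivalence with the differential formulation rests on two classical facts: an absolutely continuous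
function is the integral of its derivative, and an indefinite integral is differentiable almost everywhere.\<close>

section \<open>Integrating the derivative of an absolutely continuous function\<close>

text \<open>Absolute continuity speaks of finite sequences of intervals. This form, for tagged partial divisions, is
the one that fits the Riemann sums of the gauge integral.\<close>

lemma abs_continuous_on_tagged_partial_division:
  fixes f :: "real \<Rightarrow> 'a::metric_space"
  assumes "abs_continuous_on a b f" and "e > 0"
  obtains d where "d > 0"
    and "\<And>q. q tagged_partial_division_of {a..b} \<Longrightarrow> (\<Sum>(x,K)\<in>q. measure lborel K) < d
          \<Longrightarrow> (\<Sum>(x,K)\<in>q. dist (f (Inf K)) (f (Sup K))) < e"
proof -
  obtain d where "d > 0" and d: "\<forall>(n::nat) l r. (\<forall>i<n. a \<le> l i \<and> l i \<le> r i \<and> r i \<le> b) \<and>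
        (\<forall>i<n. \<forall>j<n. i \<noteq> j \<longrightarrow> {l i<..<r i} \<inter> {l j<..<r j} = {}) \<and>
        (\<Sum>i<n. r i - l i) < d \<longrightarrow> (\<Sum>i<n. dist (f (l i)) (f (r i))) < e"
    using assms(1)[unfolded abs_continuous_on_def, rule_format, OF \<open>e > 0\<close>] by (elim exE conjE)
  show ?thesis
  proof (rule that[OF \<open>d > 0\<close>])
    fix q :: "(real \<times> real set) set"
    assume q: "q tagged_partial_division_of {a..b}" and small: "(\<Sum>(x,K)\<in>q. measure lborel K) < d"
    have "finite q" by (rule tagged_partial_division_ofD(1)[OF q])
    then obtain n and h :: "nat \<Rightarrow> real \<times> real set" where h: "bij_betw h {..<n} q"
      using ex_bij_betw_nat_finite[of q] by (auto simp: atLeast0LessThan)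
    define l r where "l i = Inf (snd (h i))" and "r i = Sup (snd (h i))" for i
    have hq: "h i \<in> q" if "i < n" for i
      using h that by (auto simp: bij_betw_def)
    have iv: "a \<le> l i \<and> l i \<le> r i \<and> r i \<le> b \<and> snd (h i) = {l i..r i}" if "i < n" for i
    proof -
      obtain x K where xK: "h i = (x, K)" by fastforce
      have "(x, K) \<in> q" using hq[OF that] xK by simp
      then have K: "x \<in> K" "K \<subseteq> {a..b}" "\<exists>u v. K = cbox u v"
        using tagged_partial_division_ofD(2-4)[OF q] by blast+
      then obtain u v where "K = {u..v}" "u \<le> v" by (auto simp: box_real)
      then show ?thesis using K xK by (auto simp: l_def r_def)
    qed
    have "(\<Sum>i<n. dist (f (l i)) (f (r i))) < e"
    proof (rule d[rule_format, OF conjI, OF _ conjI])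
      show "\<forall>i<n. a \<le> l i \<and> l i \<le> r i \<and> r i \<le> b" using iv by blast
      show "\<forall>i<n. \<forall>j<n. i \<noteq> j \<longrightarrow> {l i<..<r i} \<inter> {l j<..<r j} = {}"
      proof (intro allI impI)
        fix i j assume ij: "i < n" "j < n" "i \<noteq> j"
        have "h i \<noteq> h j" using h ij by (metis bij_betw_imp_inj_on inj_on_def lessThan_iff)
        then have "interior (snd (h i)) \<inter> interior (snd (h j)) = {}"
          using tagged_partial_division_ofD(5)[OF q, of "fst (h i)" "snd (h i)" "fst (h j)" "snd (h j)"] hq ij
          by simp
        then show "{l i<..<r i} \<inter> {l j<..<r j} = {}"
          using iv ij by simp
      qed
      have "(\<Sum>i<n. r i - l i) = (\<Sum>i<n. (\<lambda>(x,K). measure lborel K) (h i))"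
        using iv by (intro sum.cong) (auto simp: split_def)
      also have "\<dots> = (\<Sum>(x,K)\<in>q. measure lborel K)"
        by (rule sum.reindex_bij_betw[OF h])
      finally show "(\<Sum>i<n. r i - l i) < d" using small by simp
    qed
    also have "(\<Sum>i<n. dist (f (l i)) (f (r i)))
        = (\<Sum>i<n. (\<lambda>(x,K). dist (f (Inf K)) (f (Sup K))) (h i))"
      by (simp add: l_def r_def split_def)
    also have "\<dots> = (\<Sum>(x,K)\<in>q. dist (f (Inf K)) (f (Sup K)))"
      by (rule sum.reindex_bij_betw[OF h])
    finally show "(\<Sum>(x,K)\<in>q. dist (f (Inf K)) (f (Sup K))) < e" .
  qed
qed

lemma sum_content_le_measure:
  fixes q :: "('a::euclidean_space \<times> 'a set) set"
  assumes q: "q tagged_partial_division_of S" and sub: "\<And>x K. (x, K) \<in> q \<Longrightarrow> K \<subseteq> T"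
    and T: "T \<in> lmeasurable"
  shows "(\<Sum>(x,K)\<in>q. measure lborel K) \<le> measure lebesgue T"
proof -
  have td: "q tagged_division_of \<Union>(snd ` q)"
    using q tagged_partial_division_of_Union_self by blast
  then have dv: "snd ` q division_of \<Union>(snd ` q)"
    by (rule division_of_tagged_division)
  have "(\<Sum>(x,K)\<in>q. measure lborel K) = sum (measure lborel) (snd ` q)"
    by (rule sum.over_tagged_division_lemma[OF td]) (simp add: content_eq_0_interior)
  also have "\<dots> = measure lebesgue (\<Union>(snd ` q))"
    
  proof -
    have "sum (measure lborel) (snd ` q) = sum (measure lebesgue) (snd ` q)"
      using division_ofD(4)[OF dv] by (intro sum.cong refl) (metis measure_completion sets_lborel borel_closed closed_cbox)
    then show ?thesis using content_division[OF dv] by simp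
  qed
  also have "\<dots> \<le> measure lebesgue T"
  proof (rule measure_mono_fmeasurable[OF _ _ T])
    show "\<Union>(snd ` q) \<subseteq> T" using sub by force
    show "\<Union>(snd ` q) \<in> sets lebesgue"
      using lmeasurable_division[OF dv] by blast
  qed
  finally show ?thesis .
qed

text \<open>The proof is that of the fundamental theorem of calculus for the gauge integral. The gauge forces the
intervals tagged in the exceptional set \<open>N\<close> into an open set of small measure, where absolute continuity
makes the increments of \<open>f\<close> negligible; there the integrand is replaced by 0.\<close>

lemma abs_continuous_has_integral_derivative:
  fixes f f' :: "real \<Rightarrow> 'a::euclidean_space"
  assumes "a \<le> b" and ac: "abs_continuous_on a b f" and N: "negligible N"
    and deriv: "\<And>x. x \<in> {a..b} - N \<Longrightarrow> (f has_vector_derivative f' x) (at x within {a..b})"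
  shows "(f' has_integral f b - f a) {a..b}"
proof -
  define f0 where "f0 x = (if x \<in> N then 0 else f' x)" for x
  have "(f0 has_integral f b - f a) (cbox a b)"
    unfolding has_integral
  proof (intro allI impI)
    fix e :: real assume "e > 0"
    define e1 where "e1 = e / (2 * (b - a + 1))"
    have "e1 > 0" using \<open>a \<le> b\<close> \<open>e > 0\<close> by (simp add: e1_def)
    have e1: "e1 * (b - a) < e / 2"
      using \<open>a \<le> b\<close> \<open>e > 0\<close> by (simp add: e1_def field_simps)
    obtain \<delta> where "\<delta> > 0" and \<delta>: "\<And>q. q tagged_partial_division_of {a..b} \<Longrightarrow>
        (\<Sum>(x,K)\<in>q. measure lborel K) < \<delta> \<Longrightarrow> (\<Sum>(x,K)\<in>q. dist (f (Inf K)) (f (Sup K))) < e / 2"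
      using abs_continuous_on_tagged_partial_division[OF ac, of "e/2"] \<open>e > 0\<close> by auto
    obtain T where T: "open T" "N \<subseteq> T" "(T - N) \<in> lmeasurable" "emeasure lebesgue (T - N) < ennreal \<delta>"
      using sets_lebesgue_outer_open[OF negligible_imp_sets[OF N] \<open>\<delta> > 0\<close>] by blast
    have Tm: "T \<in> lmeasurable"
      using T(2,3) negligible_imp_measurable[OF N] by (metis Diff_partition fmeasurable.Un)
    have "measure lebesgue T = measure lebesgue (T - N)"
      using N Tm by (simp add: measure_Diff_null_set negligible_iff_null_sets fmeasurableD)
    also have "\<dots> < \<delta>"
      using T(3,4) \<open>\<delta> > 0\<close> by (simp add: emeasure_eq_measure2 ennreal_less_iff)
    finally have Tless: "measure lebesgue T < \<delta>" .
    have "\<forall>x. \<exists>d>0. x \<in> {a..b} - N \<longrightarrow>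
       (\<forall>y\<in>{a..b}. norm (y-x) < d \<longrightarrow> norm (f y - f x - (y-x) *\<^sub>R f' x) \<le> e1 * norm (y-x))"
      using deriv[unfolded has_vector_derivative_def has_derivative_within_alt] \<open>e1 > 0\<close>
      by (metis zero_less_one)
    then obtain d where d0: "\<And>x. 0 < d x"
      and d: "\<And>x y. \<lbrakk>x \<in> {a..b} - N; y \<in> {a..b}; norm (y-x) < d x\<rbrakk>
                        \<Longrightarrow> norm (f y - f x - (y-x) *\<^sub>R f' x) \<le> e1 * norm (y-x)"
      by metis
    define \<gamma> where "\<gamma> x = (if x \<in> N then T else ball x (d x))" for x
    have gau: "gauge \<gamma>"
      using T(1,2) d0 by (auto simp: gauge_def \<gamma>_def)
    have main: "norm ((\<Sum>(x,K)\<in>p. measure lborel K *\<^sub>R f0 x) - (f b - f a)) < e"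
      if ptag: "p tagged_division_of cbox a b" and fine: "\<gamma> fine p" for p
    proof -
      define F where "F = (\<lambda>(x::real,K). measure lborel K *\<^sub>R f0 x - (f (Sup K) - f (Inf K)))"
      define q where "q = {(x,K) \<in> p. x \<in> N}"
      have fp: "finite p" using ptag by blast
      have ba: "b - a = (\<Sum>(x,K)\<in>p. Sup K - Inf K)" "f b - f a = (\<Sum>(x,K)\<in>p. f(Sup K) - f(Inf K))"
        using additive_tagged_division_1[where f= "\<lambda>x. x"] additive_tagged_division_1[where f= f]
              \<open>a \<le> b\<close> ptag by auto
      have "(\<Sum>(x,K)\<in>p. measure lborel K *\<^sub>R f0 x) - (f b - f a) = sum F p"
        unfolding ba(2) by (simp add: F_def split_def sum_subtractf)
      also have "\<dots> = sum F (p - q) + sum F q"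
        using fp by (intro sum.subset_diff) (auto simp: q_def)
      finally have split: "(\<Sum>(x,K)\<in>p. measure lborel K *\<^sub>R f0 x) - (f b - f a) = sum F (p - q) + sum F q" .
      have seg: "\<exists>u v. K = {u..v} \<and> u \<le> x \<and> x \<le> v \<and> a \<le> u \<and> v \<le> b" if "(x, K) \<in> p" for x K
      proof -
        have "x \<in> K" "K \<subseteq> cbox a b" "\<exists>u v. K = cbox u v"
          using tagged_division_ofD(2-4)[OF ptag that] by blast+
        then show ?thesis by (auto simp: box_real)
      qed
      have "norm (sum F (p - q)) \<le> (\<Sum>(x,K)\<in>p - q. e1 * (Sup K - Inf K))"
      proof (rule sum_norm_le, safe)
        fix x K assume xK: "(x, K) \<in> p" "(x, K) \<notin> q"
        then have xN: "x \<notin> N" by (auto simp: q_def)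
        obtain u v where K: "K = {u..v}" "u \<le> x" "x \<le> v" "a \<le> u" "v \<le> b" using seg[OF xK(1)] by blast
        have "K \<subseteq> ball x (d x)" using fineD[OF fine xK(1)] xN by (simp add: \<gamma>_def)
        then have "norm (u - x) < d x" "norm (v - x) < d x"
          using K subsetD[of K "ball x (d x)" u] subsetD[of K "ball x (d x)" v]
          by (auto simp: dist_real_def)
        then have "norm (f u - f x - (u-x) *\<^sub>R f' x) \<le> e1 * norm (u-x)"
          "norm (f v - f x - (v-x) *\<^sub>R f' x) \<le> e1 * norm (v-x)"
          using d[of x u] d[of x v] K xN by auto
        moreover have "F (x, K) = (f u - f x - (u - x) *\<^sub>R f' x) - (f v - f x - (v - x) *\<^sub>R f' x)"
          using K xN by (simp add: F_def f0_def algebra_simps)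
        ultimately have "norm (F (x, K)) \<le> e1 * norm (u-x) + e1 * norm (v-x)"
          by (smt (verit) norm_triangle_ineq4)
        also have "\<dots> = e1 * (v - u)" using K by (simp add: algebra_simps)
        finally show "norm (F (x, K)) \<le> e1 * (Sup K - Inf K)" using K by simp
      qed
      also have "\<dots> \<le> (\<Sum>(x,K)\<in>p. e1 * (Sup K - Inf K))"
      proof (rule sum_mono2[OF fp], simp)
        fix xK assume "xK \<in> p - (p - q)"
        then show "0 \<le> (case xK of (x, K) \<Rightarrow> e1 * (Sup K - Inf K))"
          using \<open>e1 > 0\<close> seg by (cases xK) fastforce
      qed
      also have "\<dots> = e1 * (b - a)"
        unfolding ba(1) by (simp add: sum_distrib_left split_def)
      finally have le1: "norm (sum F (p - q)) \<le> e1 * (b - a)" .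
      \<comment> \<open>The intervals tagged in \<open>N\<close> lie in \<open>T\<close> and do not overlap, so their total length is less than \<open>\<delta>\<close>.\<close>
      have qpart: "q tagged_partial_division_of {a..b}"
        using ptag by (auto simp: q_def box_real tagged_division_of_def intro: tagged_partial_division_subset)
      have "(\<Sum>(x,K)\<in>q. measure lborel K) \<le> measure lebesgue T"
        by (rule sum_content_le_measure[OF qpart _ Tm]) (use fineD[OF fine] in \<open>force simp: q_def \<gamma>_def\<close>)
      then have small: "(\<Sum>(x,K)\<in>q. dist (f (Inf K)) (f (Sup K))) < e / 2"
        using \<delta>[OF qpart] Tless by linarith
      have "norm (sum F q) \<le> (\<Sum>(x,K)\<in>q. dist (f (Inf K)) (f (Sup K)))"
        by (rule sum_norm_le) (auto simp: q_def F_def f0_def dist_norm)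
      then have "norm (sum F q) < e / 2" using small by linarith
      then show ?thesis
        unfolding split using le1 e1 norm_triangle_ineq[of "sum F (p - q)" "sum F q"] by linarith
    qed
    show "\<exists>\<gamma>. gauge \<gamma> \<and> (\<forall>p. p tagged_division_of cbox a b \<and> \<gamma> fine p \<longrightarrow>
        norm ((\<Sum>(x,K)\<in>p. measure lborel K *\<^sub>R f0 x) - (f b - f a)) < e)"
      by (intro exI[of _ \<gamma>] conjI gau allI impI main; elim conjE)
  qed
  then have "(f' has_integral f b - f a) (cbox a b)"
    by (rule has_integral_spike[OF N, rotated]) (simp add: f0_def)
  then show ?thesis by (simp add: box_real)
qed

section \<open>Differentiating an indefinite integral\<close>

text \<open>By Henstock's lemma the errors \<open>|F(v) - F(u) - (v - u) f(x)|\<close> have a small sum over any fine partial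
division. Intervals on which the error exceeds \<open>\<eta> (v - u)\<close> therefore have small total length, and Vitali's
covering lemma selects among them disjoint ones whose fivefold enlargements cover the bad set.\<close>

lemma negligible_large_difference_quotient:
  fixes f :: "real \<Rightarrow> 'a::euclidean_space"
  assumes f: "f integrable_on {a..b}" and "\<eta> > 0"
  defines "F \<equiv> \<lambda>x. integral {a..x} f"
  shows "negligible {x\<in>{a..b}. \<forall>d>0. \<exists>y\<in>{a..b}. \<bar>y - x\<bar> < d \<and>
            \<eta> * \<bar>y - x\<bar> < norm (F y - F x - (y - x) *\<^sub>R f x)}" (is "negligible ?B")
  unfolding negligible_outer_le
proof (intro allI impI)
  fix e :: real assume "e > 0"
  \<comment> \<open>The factor 5 is that of the enlargement in Vitali's lemma.\<close>
  have e': "\<eta> * e / 5 > 0" using \<open>e > 0\<close> \<open>\<eta> > 0\<close> by simp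
  obtain \<gamma> where \<gamma>: "gauge \<gamma>"
    and hen: "\<And>p. \<lbrakk>p tagged_partial_division_of cbox a b; \<gamma> fine p\<rbrakk> \<Longrightarrow>
               (\<Sum>(x,K)\<in>p. norm (measure lborel K *\<^sub>R f x - integral K f)) < \<eta> * e / 5"
    using Henstock_lemma[of f a b, OF _ e'] f by (auto simp: box_real)
  have "\<forall>x\<in>?B. \<exists>y. y \<in> {a..b} \<and> {min x y..max x y} \<subseteq> \<gamma> x \<and>
          \<eta> * \<bar>y - x\<bar> < norm (F y - F x - (y - x) *\<^sub>R f x)"
  proof
    fix x assume x: "x \<in> ?B"
    obtain d where "d > 0" and d: "ball x d \<subseteq> \<gamma> x"
      using gaugeD[OF \<gamma>, of x] open_contains_ball by blast
    then obtain y where y: "y \<in> {a..b}" "\<bar>y - x\<bar> < d"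
        "\<eta> * \<bar>y - x\<bar> < norm (F y - F x - (y - x) *\<^sub>R f x)"
      using x by blast
    have "{min x y..max x y} \<subseteq> ball x d"
      using y(2) by (auto simp: dist_real_def min_def max_def)
    then show "\<exists>y. y \<in> {a..b} \<and> {min x y..max x y} \<subseteq> \<gamma> x \<and>
          \<eta> * \<bar>y - x\<bar> < norm (F y - F x - (y - x) *\<^sub>R f x)"
      using y d by blast
  qed
  from bchoice[OF this] obtain Y where Y0: "\<forall>x\<in>?B. Y x \<in> {a..b} \<and> {min x (Y x)..max x (Y x)} \<subseteq> \<gamma> x \<and>
          \<eta> * \<bar>Y x - x\<bar> < norm (F (Y x) - F x - (Y x - x) *\<^sub>R f x)" by (elim exE)
  note Y = bspec[OF Y0, THEN conjunct1] bspec[OF Y0, THEN conjunct2, THEN conjunct1]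
    bspec[OF Y0, THEN conjunct2, THEN conjunct2]
  \<comment> \<open>The interval between \<open>x\<close> and \<open>Y x\<close> as a closed ball, as the covering lemma requires.\<close>
  define c r where "c x = (x + Y x) / 2" and "r x = \<bar>Y x - x\<bar> / 2" for x
  have cb: "cball (c x) (r x) = {min x (Y x)..max x (Y x)}" for x
    by (auto simp: c_def r_def dist_real_def min_def max_def field_simps abs_if split: if_splits)
  have rpos: "0 < r x \<and> r x \<le> b - a" if "x \<in> ?B" for x
  proof -
    have "Y x \<noteq> x" using Y(3)[OF that] by auto
    moreover have "a \<le> x" "x \<le> b" using that by auto
    ultimately show ?thesis using Y(1)[OF that] by (auto simp: r_def)
  qed
  obtain C where C: "countable C" "C \<subseteq> ?B"
     "pairwise (\<lambda>i j. disjnt (cball (c i) (r i)) (cball (c j) (r j))) C"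
     "?B \<subseteq> (\<Union>i\<in>C. cball (c i) (5 * r i))"
  proof (rule Vitali_covering_lemma_cballs[of ?B c r ?B "b - a"])
    show "?B \<subseteq> (\<Union>i\<in>?B. cball (c i) (r i))"
      unfolding cb by (rule subsetI, rule UN_I) auto
    show "0 < r i \<and> r i \<le> b - a" if "i \<in> ?B" for i
      by (rule rpos[OF that])
  qed blast
  have fin: "measure lebesgue (\<Union>i\<in>D. cball (c i) (5 * r i)) \<le> e" if "D \<subseteq> C" "finite D" for D
  proof -
    define p where "p = (\<lambda>x. (x, cball (c x) (r x))) ` D"
    have inj: "inj_on (\<lambda>x. (x, cball (c x) (r x))) D" by (auto simp: inj_on_def)
    have DB: "x \<in> ?B" if "x \<in> D" for x using that \<open>D \<subseteq> C\<close> C(2) by blast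
    have DI: "x \<in> {a..b}" if "x \<in> D" for x using DB[OF that] by blast
    have part: "p tagged_partial_division_of cbox a b"
      unfolding tagged_partial_division_of_def
    proof (intro conjI allI impI)
      show "finite p" using \<open>finite D\<close> by (simp add: p_def)
      fix x K assume xK: "(x, K) \<in> p"
      then have xD: "x \<in> D" and K: "K = {min x (Y x)..max x (Y x)}"
        by (auto simp: p_def cb)
      show "x \<in> K" unfolding K by auto
      show "K \<subseteq> cbox a b"
        using DI[OF xD] Y(1)[OF DB[OF xD]] unfolding K by auto
      show "\<exists>a b. K = cbox a b" unfolding K by (metis box_real(2))
    next
      fix x K x' K' assume as: "(x, K) \<in> p \<and> (x', K') \<in> p \<and> (x, K) \<noteq> (x', K')"
      then have xD: "x \<in> D" and K: "K = {min x (Y x)..max x (Y x)}"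
        by (auto simp: p_def cb)
      have "x' \<in> D" "x \<noteq> x'" and K': "K' = cball (c x') (r x')"
        using as by (auto simp: p_def)
      then have "disjnt (cball (c x) (r x)) (cball (c x') (r x'))"
        using C(3) xD \<open>D \<subseteq> C\<close> by (auto simp: pairwise_def)
      then show "interior K \<inter> interior K' = {}"
        using interior_subset[of K] interior_subset[of K'] unfolding K K' cb disjnt_def by blast
    qed
    have fine: "\<gamma> fine p"
      using Y(2)[OF DB] by (auto simp: fine_def p_def cb)
    have "5 * (\<eta> * (\<Sum>x\<in>D. 2 * r x)) \<le> 5 * (\<Sum>x\<in>D. norm (measure lborel (cball (c x) (r x)) *\<^sub>R f x - integral (cball (c x) (r x)) f))"
      unfolding sum_distrib_left
    proof (rule sum_mono)
      fix x assume x: "x \<in> D"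
      note xI = DI[OF x] and yI = Y(1)[OF DB[OF x]]
      have comb: "integral {u..v} f = F v - F u" if "u \<in> {a..b}" "v \<in> {a..b}" "u \<le> v" for u v
      proof -
        have "integral {a..u} f + integral {u..v} f = integral {a..v} f"
          using that by (intro Henstock_Kurzweil_Integration.integral_combine) (auto intro: integrable_subinterval_real[OF f])
        then show ?thesis by (simp add: F_def algebra_simps)
      qed
      have "norm (measure lborel (cball (c x) (r x)) *\<^sub>R f x - integral (cball (c x) (r x)) f)
         = norm (F (Y x) - F x - (Y x - x) *\<^sub>R f x)"
      proof (cases "x \<le> Y x")
        case True
        then show ?thesis unfolding cb using comb[OF xI yI True]
          by (simp add: min_def max_def norm_minus_commute)
      next
        case False
        then have "measure lborel (cball (c x) (r x)) *\<^sub>R f x - integral (cball (c x) (r x)) f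
            = F (Y x) - F x - (Y x - x) *\<^sub>R f x"
          unfolding cb using comb[OF yI xI] by (simp add: min_def max_def algebra_simps)
        then show ?thesis by simp
      qed
      then show "5 * (\<eta> * (2 * r x)) \<le> 5 * norm (measure lborel (cball (c x) (r x)) *\<^sub>R f x - integral (cball (c x) (r x)) f)"
        using Y(3)[OF DB[OF x]] by (simp add: r_def)
    qed
    also have "\<dots> = 5 * (\<Sum>(x,K)\<in>p. norm (measure lborel K *\<^sub>R f x - integral K f))"
      unfolding p_def by (subst sum.reindex[OF inj]) simp
    also have "\<dots> < \<eta> * e" using hen[OF part fine] by simp
    finally have "5 * (\<Sum>x\<in>D. 2 * r x) < e"
      using \<open>\<eta> > 0\<close> by (simp add: mult.left_commute)
    moreover have "measure lebesgue (\<Union>i\<in>D. cball (c i) (5 * r i)) \<le> (\<Sum>i\<in>D. measure lebesgue (cball (c i) (5 * r i)))"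
      by (rule measure_UNION_le[OF \<open>finite D\<close>]) auto
    moreover have "(\<Sum>i\<in>D. measure lebesgue (cball (c i) (5 * r i))) = 5 * (\<Sum>x\<in>D. 2 * r x)"
      unfolding sum_distrib_left
    proof (rule sum.cong[OF refl])
      fix x assume "x \<in> D"
      then have "r x > 0" using rpos[OF DB] by blast
      then show "measure lebesgue (cball (c x) (5 * r x)) = 5 * (2 * r x)"
        by (simp add: cball_eq_atLeastAtMost)
    qed
    ultimately show ?thesis by linarith
  qed
  show "\<exists>T. ?B \<subseteq> T \<and> T \<in> lmeasurable \<and> measure lebesgue T \<le> e"
  proof (intro exI conjI)
    show "?B \<subseteq> (\<Union>i\<in>C. cball (c i) (5 * r i))" by (rule C(4))
    show "(\<Union>i\<in>C. cball (c i) (5 * r i)) \<in> lmeasurable"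
      by (rule fmeasurable_UN_bound[OF C(1) _ fin]) auto
    show "measure lebesgue (\<Union>i\<in>C. cball (c i) (5 * r i)) \<le> e"
      by (rule measure_UN_bound[OF C(1) _ fin]) auto
  qed
qed

text \<open>Lebesgue's differentiation theorem on the line: non-differentiability at \<open>x\<close> with derivative \<open>f x\<close> puts
\<open>x\<close> in one of countably many of the negligible sets above.\<close>

theorem has_vector_derivative_indefinite_integral_ae:
  fixes f :: "real \<Rightarrow> 'a::euclidean_space"
  assumes f: "f integrable_on {a..b}"
  shows "negligible {x\<in>{a..b}. \<not> ((\<lambda>x. integral {a..x} f) has_vector_derivative f x) (at x within {a..b})}"
proof -
  define F where "F x = integral {a..x} f" for x
  define B where "B \<eta> = {x\<in>{a..b}. \<forall>d>0. \<exists>y\<in>{a..b}. \<bar>y - x\<bar> < d \<and>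
            \<eta> * \<bar>y - x\<bar> < norm (F y - F x - (y - x) *\<^sub>R f x)}" for \<eta>
  have "negligible (\<Union>n. B (inverse (real (Suc n))))"
    unfolding B_def F_def
    by (intro negligible_Union_nat negligible_large_difference_quotient[OF f]) simp
  moreover have "x \<in> (\<Union>n. B (inverse (real (Suc n))))"
    if x: "x \<in> {a..b}" "\<not> (F has_vector_derivative f x) (at x within {a..b})" for x
  proof -
    obtain e where "e > 0" and e: "\<And>d. d > 0 \<Longrightarrow> \<exists>y\<in>{a..b}. norm (y - x) < d \<and>
        \<not> norm (F y - F x - (y - x) *\<^sub>R f x) \<le> e * norm (y - x)"
      using x(2) unfolding has_vector_derivative_def has_derivative_within_alt
      by (auto simp: bounded_linear_scaleR_left)
    obtain n where n: "inverse (real (Suc n)) < e"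
      using reals_Archimedean[OF \<open>e > 0\<close>] by auto
    have "x \<in> B (inverse (real (Suc n)))"
      unfolding B_def
    proof (intro CollectI conjI allI impI x(1))
      fix d :: real assume "d > 0"
      then obtain y where y: "y \<in> {a..b}" "norm (y - x) < d"
        "e * norm (y - x) < norm (F y - F x - (y - x) *\<^sub>R f x)"
        using e[OF \<open>d > 0\<close>] by (auto simp: not_le)
      have "inverse (real (Suc n)) * \<bar>y - x\<bar> \<le> e * \<bar>y - x\<bar>"
        using n by (intro mult_right_mono) auto
      then show "\<exists>y\<in>{a..b}. \<bar>y - x\<bar> < d \<and>
          inverse (real (Suc n)) * \<bar>y - x\<bar> < norm (F y - F x - (y - x) *\<^sub>R f x)"
        using y by (intro bexI[of _ y]) auto
    qed
    then show ?thesis by blast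
  qed
  ultimately show ?thesis
    by (elim negligible_subset) (auto simp: F_def[abs_def])
qed

section \<open>Trajectories as solutions of an integral equation\<close>

lemma has_integral_translate:
  fixes f :: "real \<Rightarrow> 'a::real_normed_vector"
  shows "((\<lambda>x. f (s + x)) has_integral I) {a..b} \<longleftrightarrow> (f has_integral I) {s + a..s + b}"
  using has_integral_affinity_iff[of 1 f s I "s + a" "s + b"]
  by (simp add: add.commute)

lemma continuous_on_halfline:
  fixes p :: "real \<Rightarrow> 'a::metric_space"
  assumes "\<And>T. T \<ge> 0 \<Longrightarrow> continuous_on {0..T} p"
  shows "continuous_on {0..} p"
  unfolding continuous_on_eq_continuous_within
proof
  fix t :: real assume t: "t \<in> {0..}"
  have "continuous (at t within {0..t+1}) p"
    using assms[of "t + 1"] t by (auto simp: continuous_on_eq_continuous_within)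
  moreover have "at t within {0..t+1} = at t within {0..}"
    by (rule at_within_nhd[of _ "{..<t+1}"]) (use t in auto)
  ultimately show "continuous (at t within {0..}) p" by simp
qed

text \<open>The Borel sets of a product are in general more than the product sigma-algebra when a factor is not
separable. One second countable factor suffices to write every open set as a countable union of open
rectangles, so the space of controls can be an arbitrary metric space.\<close>

lemma measurable_Pair_borel_second_countable:
  fixes f :: "'m \<Rightarrow> 'a::{second_countable_topology}" and u :: "'m \<Rightarrow> 'u::topological_space"
  assumes f: "f \<in> borel_measurable M" and u: "u \<in> borel_measurable M"
  shows "(\<lambda>x. (f x, u x)) \<in> borel_measurable M"
proof (rule borel_measurableI)
  fix W :: "('a \<times> 'u) set" assume W: "open W"
  obtain \<B> :: "'a set set" where \<B>: "countable \<B>" "topological_basis \<B>"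
    using ex_countable_basis by blast
  define V where "V b = \<Union>{V :: 'u set. open V \<and> b \<times> V \<subseteq> W}" for b
  have "W = (\<Union>b\<in>\<B>. b \<times> V b)"
  proof (intro equalityI subsetI)
    fix w assume "w \<in> W"
    then obtain A B where AB: "open A" "open B" "w \<in> A \<times> B" "A \<times> B \<subseteq> W"
      using W open_prod_elim by blast
    then obtain b where b: "b \<in> \<B>" "fst w \<in> b" "b \<subseteq> A"
      using topological_basisE[OF \<B>(2) AB(1)] by (metis mem_Times_iff)
    then have "w \<in> b \<times> V b"
      using AB by (force simp: V_def mem_Times_iff)
    then show "w \<in> (\<Union>b\<in>\<B>. b \<times> V b)" using b by blast
  qed (auto simp: V_def)
  then have "(\<lambda>x. (f x, u x)) -` W \<inter> space M = (\<Union>b\<in>\<B>. (f -` b \<inter> space M) \<inter> (u -` V b \<inter> space M))"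
    by auto
  also have "\<dots> \<in> sets M"
  proof (rule sets.countable_UN''[OF \<B>(1)], rule sets.Int)
    fix b assume "b \<in> \<B>"
    then have "open b" using \<B>(2) topological_basis_open by blast
    then show "f -` b \<inter> space M \<in> sets M" using f by (auto intro: measurable_sets)
    have "open (V b)" by (auto simp: V_def)
    then show "u -` V b \<inter> space M \<in> sets M" using u by (auto intro: measurable_sets)
  qed
  finally show "(\<lambda>x. (f x, u x)) -` W \<inter> space M \<in> sets M" .
qed

text \<open>Caratheodory solutions in integrated form. Shifting and gluing solutions become additivity of the integral,
free of exceptional null sets, and increments are estimated by bounding the integrand.\<close>

definition integral_solution ::
  "('a::euclidean_space \<times> 'u \<Rightarrow> 'a) \<Rightarrow> (real \<Rightarrow> 'u) \<Rightarrow> 'a \<Rightarrow> (real \<Rightarrow> 'a) \<Rightarrow> bool" where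
  "integral_solution g u z p \<longleftrightarrow>
     (\<forall>t\<ge>0. ((\<lambda>s. g (p s, u s)) has_integral p t - z) {0..t})"

lemma integral_solution_start: "integral_solution g u z p \<Longrightarrow> p 0 = z"
proof -
  assume "integral_solution g u z p"
  then have "((\<lambda>s. g (p s, u s)) has_integral p 0 - z) {0..0}"
    by (simp only: integral_solution_def)
  from has_integral_unique[OF this, of 0] show "p 0 = z"
    using has_integral_refl(2)[of "\<lambda>s. g (p s, u s)" 0] by simp
qed

lemma integral_solution_continuous:
  assumes "integral_solution g u z p"
  shows "continuous_on {0..} p"
proof (rule continuous_on_halfline)
  fix T :: real assume "T \<ge> 0"
  then have "(\<lambda>s. g (p s, u s)) integrable_on {0..T}"
    using assms by (auto simp: integral_solution_def)
  then have "continuous_on {0..T} (\<lambda>t. z + integral {0..t} (\<lambda>s. g (p s, u s)))"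
    by (intro continuous_intros indefinite_integral_continuous_1)
  moreover have "z + integral {0..t} (\<lambda>s. g (p s, u s)) = p t" if "t \<in> {0..T}" for t
    using assms that by (auto simp: integral_solution_def dest!: spec[of _ t] integral_unique)
  ultimately show "continuous_on {0..T} p"
    by (rule continuous_on_eq)
qed

lemma integral_solution_increment:
  assumes p: "integral_solution g u z p" and st: "0 \<le> s" "s \<le> t"
  shows "((\<lambda>r. g (p r, u r)) has_integral p t - p s) {s..t}"
proof -
  let ?f = "\<lambda>r. g (p r, u r)"
  have s: "(?f has_integral p s - z) {0..s}" and t: "(?f has_integral p t - z) {0..t}"
    using p st by (auto simp: integral_solution_def)
  have "?f integrable_on {s..t}"
    using t st by (meson atLeastatMost_subset_iff has_integral_integrable integrable_subinterval_real order_refl)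
  then obtain j where j: "(?f has_integral j) {s..t}" by blast
  have "(?f has_integral (p s - z) + j) {0..t}"
    by (rule has_integral_combine[OF st s j])
  then have "p t - z = (p s - z) + j" using t has_integral_unique by blast
  then have "j = p t - p s" by (simp add: algebra_simps)
  then show ?thesis using j by simp
qed

lemma integral_solution_shift:
  assumes "integral_solution g u z p" "0 \<le> s"
  shows "integral_solution g (\<lambda>t. u (s + t)) (p s) (\<lambda>t. p (s + t))"
  unfolding integral_solution_def
proof (intro allI impI)
  fix t :: real assume "0 \<le> t"
  then show "((\<lambda>r. g (p (s + r), u (s + r))) has_integral p (s + t) - p s) {0..t}"
    using integral_solution_increment[OF assms, of "s + t"]
      has_integral_translate[of "\<lambda>r. g (p r, u r)" s "p (s + t) - p s" 0 t] by simp
qed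

lemma lipschitz_imp_abs_continuous_on:
  assumes "K \<ge> 0" and "\<And>s t. a \<le> s \<Longrightarrow> s \<le> t \<Longrightarrow> t \<le> b \<Longrightarrow> dist (f s) (f t) \<le> K * (t - s)"
  shows "abs_continuous_on a b f"
  unfolding abs_continuous_on_def
proof (intro allI impI)
  fix e :: real assume "e > 0"
  show "\<exists>\<delta>>0. \<forall>(n::nat) l r. (\<forall>i<n. a \<le> l i \<and> l i \<le> r i \<and> r i \<le> b) \<and>
        (\<forall>i<n. \<forall>j<n. i \<noteq> j \<longrightarrow> {l i<..<r i} \<inter> {l j<..<r j} = {}) \<and>
        (\<Sum>i<n. r i - l i) < \<delta> \<longrightarrow> (\<Sum>i<n. dist (f (l i)) (f (r i))) < e"
  proof (intro exI[of _ "e / (K + 1)"] conjI allI impI)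
    show "e / (K + 1) > 0" using \<open>e > 0\<close> \<open>K \<ge> 0\<close> by simp
    fix n :: nat and l r :: "nat \<Rightarrow> real"
    assume as: "(\<forall>i<n. a \<le> l i \<and> l i \<le> r i \<and> r i \<le> b) \<and>
        (\<forall>i<n. \<forall>j<n. i \<noteq> j \<longrightarrow> {l i<..<r i} \<inter> {l j<..<r j} = {}) \<and>
        (\<Sum>i<n. r i - l i) < e / (K + 1)"
    have "(\<Sum>i<n. dist (f (l i)) (f (r i))) \<le> (\<Sum>i<n. K * (r i - l i))"
      using as by (intro sum_mono assms(2)) auto
    also have "\<dots> = K * (\<Sum>i<n. r i - l i)" by (simp add: sum_distrib_left)
    also have "\<dots> \<le> K * (e / (K + 1))"
      using as \<open>K \<ge> 0\<close> by (intro mult_left_mono) auto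
    also have "\<dots> < e" using \<open>e > 0\<close> \<open>K \<ge> 0\<close> by (simp add: field_simps)
    finally show "(\<Sum>i<n. dist (f (l i)) (f (r i))) < e" .
  qed
qed

lemma integral_exp_bound:
  fixes f :: "real \<Rightarrow> 'a::euclidean_space"
  assumes f: "(f has_integral i) {0..t}" and "0 \<le> t" "0 < c" "0 \<le> M"
    and bound: "\<And>s. s \<in> {0..t} \<Longrightarrow> norm (f s) \<le> M * exp (c * s)"
  shows "norm i \<le> M / c * exp (c * t)"
proof -
  have ex: "((\<lambda>s. M * exp (c * s)) has_integral (M / c * exp (c * t) - M / c * exp (c * 0))) {0..t}"
    by (rule fundamental_theorem_of_calculus[OF \<open>0 \<le> t\<close>])
      (use \<open>0 < c\<close> in \<open>auto intro!: derivative_eq_intros simp: has_real_derivative_iff_has_vector_derivative[symmetric]\<close>)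
  have "norm (integral {0..t} f) \<le> integral {0..t} (\<lambda>s. M * exp (c * s))"
    by (rule integral_norm_bound_integral) (use f ex bound in auto)
  then have "norm i \<le> M / c * exp (c * t) - M / c"
    using integral_unique[OF f] integral_unique[OF ex] by simp
  then show ?thesis using \<open>0 < c\<close> \<open>0 \<le> M\<close> by (smt (verit) divide_nonneg_pos)
qed

locale control_system =
  fixes g :: "'a::euclidean_space \<times> 'u::metric_space \<Rightarrow> 'a" and L a :: real
  assumes g_measurable: "g \<in> borel_measurable borel"
    and L_nonneg: "L \<ge> 0"
    and g_lipschitz: "norm (g (y, u) - g (y', u)) \<le> L * norm (y - y')"
    and a_pos: "a > 0"
    and g_growth: "norm (g (y, u)) \<le> a * (1 + norm y)"
begin

lemma integral_solution_speed:
  assumes p: "integral_solution g u z p" and st: "0 \<le> s" "s \<le> t"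
    and R: "\<And>r. s \<le> r \<Longrightarrow> r \<le> t \<Longrightarrow> norm (p r) \<le> R"
  shows "norm (p t - p s) \<le> a * (1 + R) * (t - s)"
proof -
  have "R \<ge> 0" using R[of s] st norm_ge_zero[of "p s"] by linarith
  have "norm (p t - p s) \<le> a * (1 + R) * measure lborel (cbox s t)"
  proof (rule has_integral_bound)
    show "((\<lambda>r. g (p r, u r)) has_integral p t - p s) (cbox s t)"
      using integral_solution_increment[OF p st] by simp
    show "0 \<le> a * (1 + R)" using a_pos \<open>R \<ge> 0\<close> by simp
    show "norm (g (p r, u r)) \<le> a * (1 + R)" if "r \<in> cbox s t" for r
    proof -
      have "norm (g (p r, u r)) \<le> a * (1 + norm (p r))" by (rule g_growth)
      also have "\<dots> \<le> a * (1 + R)" using R[of r] that a_pos by (intro mult_left_mono) auto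
      finally show ?thesis .
    qed
  qed
  then show ?thesis using st by simp
qed

text \<open>By linear growth the integrand is bounded along a continuous path on a compact interval, so the path is
Lipschitz there; the differential equation is Lebesgue's differentiation theorem.\<close>

lemma integral_solution_imp_solution:
  assumes p: "integral_solution g u z p"
  shows "solution g u z p"
  unfolding solution_def
proof (intro conjI allI impI)
  show "p 0 = z" by (rule integral_solution_start[OF p])
next
  fix T :: real assume "T \<ge> 0"
  have "compact (p ` {0..T})"
    using integral_solution_continuous[OF p] by (intro compact_continuous_image) (auto intro: continuous_on_subset)
  then obtain R where R: "\<And>r. r \<in> {0..T} \<Longrightarrow> norm (p r) \<le> R"
    by (meson compact_imp_bounded bounded_iff imageI)
  have "R \<ge> 0" using order_trans[OF norm_ge_zero R[of 0]] \<open>T \<ge> 0\<close> by simp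
  show "abs_continuous_on 0 T p"
  proof (rule lipschitz_imp_abs_continuous_on)
    show "0 \<le> a * (1 + R)" using a_pos \<open>R \<ge> 0\<close> by simp
    show "dist (p s) (p t) \<le> a * (1 + R) * (t - s)" if "0 \<le> s" "s \<le> t" "t \<le> T" for s t
      using integral_solution_speed[OF p that(1,2), of R] R that by (auto simp: dist_norm norm_minus_commute)
  qed
next
  let ?f = "\<lambda>s. g (p s, u s)"
  define bad where "bad n = {x\<in>{0..real n}. \<not> ((\<lambda>x. integral {0..x} ?f) has_vector_derivative ?f x) (at x within {0..real n})}" for n
  have "?f integrable_on {0..real n}" for n
    using p[unfolded integral_solution_def, rule_format, of "real n"]
    by (simp add: has_integral_integrable)
  then have "negligible (\<Union>n. bad n)"
    unfolding bad_def by (intro negligible_Union_nat has_vector_derivative_indefinite_integral_ae)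
  moreover have "(p has_vector_derivative ?f s) (at s within {0..})" if s: "s \<ge> 0" "s \<notin> (\<Union>n. bad n)" for s
  proof -
    obtain n :: nat where n: "s < real n" using reals_Archimedean2 by blast
    have "((\<lambda>x. integral {0..x} ?f) has_vector_derivative ?f s) (at s within {0..real n})"
      using s n by (auto simp: bad_def)
    from has_vector_derivative_add[OF has_vector_derivative_const[of z] this]
    have der: "((\<lambda>x. z + integral {0..x} ?f) has_vector_derivative ?f s) (at s within {0..real n})"
      by simp
    have eq: "p x = z + integral {0..x} ?f" if "x \<in> {0..real n}" for x
      using p that by (auto simp: integral_solution_def dest!: spec[of _ x] integral_unique)
    have "(p has_vector_derivative ?f s) (at s within {0..real n})"
      by (rule has_vector_derivative_transform[OF _ eq der]) (use s n in auto)
    moreover have "at s within {0..real n} = at s within {0..}"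
      by (rule at_within_nhd[of _ "{..<real n}"]) (use s n in auto)
    ultimately show ?thesis by simp
  qed
  ultimately show "AE s in lebesgue. s \<ge> 0 \<longrightarrow> (p has_vector_derivative ?f s) (at s within {0..})"
    unfolding eventually_ae_filter negligible_iff_null_sets by blast
qed

lemma solution_imp_integral_solution:
  assumes p: "solution g u z p"
  shows "integral_solution g u z p"
  unfolding integral_solution_def
proof (intro allI impI)
  fix T :: real assume "T \<ge> 0"
  obtain N where N: "N \<in> null_sets lebesgue"
    and der: "\<And>s. s \<ge> 0 \<Longrightarrow> s \<notin> N \<Longrightarrow> (p has_vector_derivative g (p s, u s)) (at s within {0..})"
    using p unfolding solution_def eventually_ae_filter by auto
  have "((\<lambda>s. g (p s, u s)) has_integral p T - p 0) {0..T}"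
  proof (rule abs_continuous_has_integral_derivative[OF \<open>T \<ge> 0\<close>])
    show "abs_continuous_on 0 T p" using p \<open>T \<ge> 0\<close> by (auto simp: solution_def)
    show "negligible N" using N by (simp add: negligible_iff_null_sets)
    show "(p has_vector_derivative g (p s, u s)) (at s within {0..T})" if "s \<in> {0..T} - N" for s
      by (rule has_vector_derivative_within_subset[OF der]) (use that in auto)
  qed
  then show "((\<lambda>s. g (p s, u s)) has_integral p T - z) {0..T}"
    using p by (simp add: solution_def)
qed

lemma solution_iff_integral_solution: "solution g u z p \<longleftrightarrow> integral_solution g u z p"
  using integral_solution_imp_solution solution_imp_integral_solution by blast

text \<open>Gronwall's argument in the form of a weighted maximum: the maximum of \<open>e\<^sup>-\<^sup>c\<^sup>t |p - q|\<close> is at most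
\<open>L/c < 1\<close> times itself.\<close>

lemma integral_solution_unique:
  assumes p: "integral_solution g u z p" and q: "integral_solution g u z q" and "t \<ge> 0"
  shows "p t = q t"
proof -
  define c where "c = L + 1"
  define w where "w s = exp (- c * s) * norm (p s - q s)" for s
  have "c > 0" using L_nonneg by (simp add: c_def)
  have "continuous_on {0..t} w"
    unfolding w_def using integral_solution_continuous[OF p] integral_solution_continuous[OF q]
    by (intro continuous_intros) (auto intro: continuous_on_subset)
  then obtain r where r: "r \<in> {0..t}" and rmax: "\<And>s. s \<in> {0..t} \<Longrightarrow> w s \<le> w r"
    using continuous_attains_sup[of "{0..t}" w] \<open>t \<ge> 0\<close> by auto
  have wr: "w r \<ge> 0" by (simp add: w_def)
  have int: "((\<lambda>s. g (p s, u s) - g (q s, u s)) has_integral (p r - z) - (q r - z)) {0..r}"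
    using p q r by (intro has_integral_diff) (auto simp: integral_solution_def)
  have "norm ((p r - z) - (q r - z)) \<le> L * w r / c * exp (c * r)"
  proof (rule integral_exp_bound[OF int])
    fix s assume s: "s \<in> {0..r}"
    have "norm (g (p s, u s) - g (q s, u s)) \<le> L * norm (p s - q s)" by (rule g_lipschitz)
    also have "norm (p s - q s) = w s * exp (c * s)" by (simp add: w_def exp_minus)
    also have "L * (w s * exp (c * s)) \<le> L * (w r * exp (c * s))"
      using rmax[of s] s r L_nonneg by (intro mult_left_mono mult_right_mono) auto
    finally show "norm (g (p s, u s) - g (q s, u s)) \<le> L * w r * exp (c * s)" by (simp add: mult.assoc)
  qed (use r wr \<open>c > 0\<close> L_nonneg in auto)
  then have "w r \<le> exp (- c * r) * (L * w r / c * exp (c * r))"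
    unfolding w_def[of r] by (intro mult_left_mono) auto
  also have "\<dots> = L / c * w r" by (simp add: exp_minus)
  finally have "(1 - L / c) * w r \<le> 0" by (simp add: algebra_simps)
  moreover have "1 - L / c > 0" using L_nonneg by (simp add: c_def field_simps)
  ultimately have "w r \<le> 0" by (simp add: mult_le_0_iff)
  then have "w t \<le> 0" using rmax[of t] \<open>t \<ge> 0\<close> by auto
  then show ?thesis by (simp add: w_def mult_le_0_iff)
qed

lemma traj_eq_integral_solution:
  assumes "integral_solution g u z p" "t \<ge> 0"
  shows "traj g t u z = p t"
  unfolding traj_def solution_iff_integral_solution
  by (rule the_equality) (use assms integral_solution_unique in blast)+

end

section \<open>Existence and concatenation of trajectories\<close>

lemma controls_iff_extension:
  "u \<in> controls \<longleftrightarrow> (\<lambda>t. if t \<in> {0..} then u t else c) \<in> borel_measurable lebesgue"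
  unfolding controls_def by (rule measurable_restrict_space_iff) auto

lemma translation_lebesgue_measurable: "(\<lambda>t::real. s + t) \<in> lebesgue \<rightarrow>\<^sub>M lebesgue"
  using lebesgue_affine_measurable[of "\<lambda>_::real. 1" s] by simp

lemma controls_shift:
  assumes "u \<in> controls" "0 \<le> s"
  shows "(\<lambda>t. u (s + t)) \<in> controls"
proof -
  let ?v = "\<lambda>t. if t \<in> {0..} then u t else u 0"
  have "(\<lambda>t. ?v (s + t)) \<in> borel_measurable lebesgue"
    using assms(1) controls_iff_extension
    by (intro measurable_compose[OF translation_lebesgue_measurable]) blast
  then have "(\<lambda>t. ?v (s + t)) \<in> borel_measurable (lebesgue_on {0..})"
    by (rule measurable_restrict_space1)
  also have "?this \<longleftrightarrow> (\<lambda>t. u (s + t)) \<in> borel_measurable (lebesgue_on {0..})"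
    by (rule measurable_cong) (use assms(2) in auto)
  finally show ?thesis by (simp add: controls_def)
qed

lemma controls_const: "(\<lambda>_. v) \<in> controls"
  by (simp add: controls_def)

text \<open>The index of the block of lengths \<open>l 0, l 1, \<dots>\<close> that contains the date \<open>t\<close>.\<close>

definition stage :: "(nat \<Rightarrow> real) \<Rightarrow> real \<Rightarrow> nat" where
  "stage l t = (LEAST n. t < (\<Sum>i<Suc n. l i))"

lemma stage_eq:
  fixes l :: "nat \<Rightarrow> real"
  assumes "\<And>i. 0 < l i" "(\<Sum>i<n. l i) \<le> t" "t < (\<Sum>i<Suc n. l i)"
  shows "stage l t = n"
  unfolding stage_def
proof (rule Least_equality)
  fix m assume m: "t < (\<Sum>i<Suc m. l i)"
  show "n \<le> m"
  proof (rule ccontr)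
    assume "\<not> n \<le> m"
    then have "(\<Sum>i<Suc m. l i) \<le> (\<Sum>i<n. l i)"
      using assms(1) by (intro sum_mono2) (auto intro: less_imp_le)
    then show False using m assms(2) by linarith
  qed
qed fact

lemma stage_exists:
  fixes l :: "nat \<Rightarrow> real"
  assumes pos: "\<And>i. 0 < l i" and unb: "\<And>x. \<exists>n. x < (\<Sum>i<n. l i)" and "0 \<le> t"
  shows "(\<Sum>i<stage l t. l i) \<le> t" "t < (\<Sum>i<Suc (stage l t). l i)"
proof -
  obtain n where n: "t < (\<Sum>i<n. l i)" using unb by blast
  then obtain m where "n = Suc m" using \<open>0 \<le> t\<close> by (cases n) auto
  with n have ex: "t < (\<Sum>i<Suc m. l i)" by simp
  show "t < (\<Sum>i<Suc (stage l t). l i)"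
    unfolding stage_def by (rule LeastI[of "\<lambda>n. t < (\<Sum>i<Suc n. l i)", OF ex])
  show "(\<Sum>i<stage l t. l i) \<le> t"
  proof (cases "stage l t")
    case 0 then show ?thesis using \<open>0 \<le> t\<close> by simp
  next
    case (Suc k)
    then have "k < stage l t" by simp
    then have "\<not> t < (\<Sum>i<Suc k. l i)"
      unfolding stage_def by (rule not_less_Least)
    then show ?thesis using Suc by simp
  qed
qed

context control_system
begin

lemma g_along_measurable:
  assumes "continuous_on {0..} p" "u \<in> controls"
  shows "(\<lambda>s. g (p s, u s)) \<in> borel_measurable (lebesgue_on {0..})"
proof -
  have "(\<lambda>s. (p s, u s)) \<in> borel_measurable (lebesgue_on {0..})"
    by (rule measurable_Pair_borel_second_countable)
      (use assms in \<open>auto simp: controls_def intro: continuous_imp_measurable_on_sets_lebesgue\<close>)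
  then show ?thesis by (rule measurable_compose[OF _ g_measurable])
qed

text \<open>Picard iteration on the whole half-line at once: for the unknown \<open>x(t) = e\<^sup>-\<^sup>c\<^sup>t p(t)\<close> with \<open>c = L + 1\<close>, the
integral equation is a fixed point problem for a contraction of the bounded continuous functions. Linear
growth of \<open>g\<close> keeps the weighted iterates bounded. Such functions live on all of the line, hence the
constant extension by \<open>max 0 t\<close>.\<close>

theorem integral_solution_exists:
  assumes u: "u \<in> controls"
  shows "\<exists>p. integral_solution g u z p"
proof -
  define c where "c = L + 1"
  have "c > 0" using L_nonneg by (simp add: c_def)
  define G where "G x s = g (exp (c * s) *\<^sub>R apply_bcontfun x s, u s)" for x :: "real \<Rightarrow>\<^sub>C 'a" and s
  define \<phi> where "\<phi> x t = exp (- c * t) *\<^sub>R (z + integral {0..t} (G x))" for x t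
  define M where "M x = a * (1 + norm x)" for x :: "real \<Rightarrow>\<^sub>C 'a"
  have M0: "M x \<ge> 0" for x using a_pos by (simp add: M_def)
  have Gb: "norm (G x s) \<le> M x * exp (c * s)" if "s \<ge> 0" for x s
  proof -
    have "norm (G x s) \<le> a * (1 + norm (exp (c * s) *\<^sub>R apply_bcontfun x s))"
      unfolding G_def by (rule g_growth)
    also have "\<dots> \<le> a * (exp (c * s) + exp (c * s) * norm x)"
      using a_pos \<open>c > 0\<close> that norm_bounded[of x s] by (intro mult_left_mono add_mono) auto
    finally show ?thesis by (simp add: M_def algebra_simps)
  qed
  have Gint: "G x integrable_on {0..t}" for x t
  proof (rule measurable_bounded_by_integrable_imp_integrable)
    have "G x \<in> borel_measurable (lebesgue_on {0..})"
      unfolding G_def by (intro g_along_measurable u continuous_intros continuous_on_apply_bcontfun)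
    then show "G x \<in> borel_measurable (lebesgue_on {0..t})"
      by (rule measurable_restrict_mono) auto
    show "(\<lambda>s. M x * exp (c * s)) integrable_on {0..t}"
      by (intro integrable_continuous_interval continuous_intros)
    show "norm (G x s) \<le> M x * exp (c * s)" if "s \<in> {0..t}" for s
      using Gb that by simp
  qed simp
  have \<phi>b: "norm (\<phi> x t) \<le> norm z + M x / c" if "t \<ge> 0" for x t
  proof -
    have "norm (integral {0..t} (G x)) \<le> M x / c * exp (c * t)"
      by (rule integral_exp_bound[OF integrable_integral[OF Gint] that \<open>c > 0\<close> M0]) (use Gb in auto)
    then have "norm (z + integral {0..t} (G x)) \<le> norm z + M x / c * exp (c * t)"
      using norm_triangle_ineq[of z "integral {0..t} (G x)"] by linarith
    then have "norm (\<phi> x t) \<le> exp (- c * t) * (norm z + M x / c * exp (c * t))"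
      unfolding \<phi>_def by (simp del: mult_minus_left)
    also have "\<dots> = exp (- c * t) * norm z + M x / c" by (simp add: exp_minus algebra_simps)
    also have "\<dots> \<le> norm z + M x / c"
      using that \<open>c > 0\<close> by (simp add: mult_left_le_one_le)
    finally show ?thesis .
  qed
  have \<phi>c: "continuous_on {0..} (\<phi> x)" for x
    unfolding \<phi>_def
    by (rule continuous_on_halfline) (intro continuous_intros indefinite_integral_continuous_1 Gint)
  have mem: "(\<lambda>t. \<phi> x (max 0 t)) \<in> bcontfun" for x
  proof (rule bcontfun_normI)
    show "continuous_on UNIV (\<lambda>t. \<phi> x (max 0 t))"
      by (rule continuous_on_compose2[OF \<phi>c]) (auto intro!: continuous_intros)
    show "norm (\<phi> x (max 0 t)) \<le> norm z + M x / c" for t by (rule \<phi>b) simp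
  qed
  define \<Phi> where "\<Phi> x = Bcontfun (\<lambda>t. \<phi> x (max 0 t))" for x
  have \<Phi>: "apply_bcontfun (\<Phi> x) t = \<phi> x (max 0 t)" for x t
    unfolding \<Phi>_def by (simp add: Bcontfun_inverse mem)
  have "dist (\<Phi> x) (\<Phi> y) \<le> L / c * dist x y" for x y
  proof (rule dist_bound)
    fix t' :: real
    define t where "t = max 0 t'"
    have "t \<ge> 0" by (simp add: t_def)
    have int: "((\<lambda>s. G x s - G y s) has_integral integral {0..t} (G x) - integral {0..t} (G y)) {0..t}"
      by (intro has_integral_diff integrable_integral Gint)
    have "norm (integral {0..t} (G x) - integral {0..t} (G y)) \<le> L * dist x y / c * exp (c * t)"
    proof (rule integral_exp_bound[OF int])
      fix s assume "s \<in> {0..t}"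
      have "norm (G x s - G y s) \<le> L * norm (exp (c * s) *\<^sub>R apply_bcontfun x s - exp (c * s) *\<^sub>R apply_bcontfun y s)"
        unfolding G_def by (rule g_lipschitz)
      also have "\<dots> = L * (exp (c * s) * dist (apply_bcontfun x s) (apply_bcontfun y s))"
        by (simp add: dist_norm flip: scaleR_diff_right)
      also have "\<dots> \<le> L * (exp (c * s) * dist x y)"
        using L_nonneg dist_bounded[of x s y] by (intro mult_left_mono) auto
      finally show "norm (G x s - G y s) \<le> L * dist x y * exp (c * s)" by (simp add: mult_ac)
    qed (use \<open>t \<ge> 0\<close> \<open>c > 0\<close> L_nonneg in auto)
    then have "exp (- c * t) * norm (integral {0..t} (G x) - integral {0..t} (G y))
        \<le> exp (- c * t) * (L * dist x y / c * exp (c * t))"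
      by (intro mult_left_mono) auto
    also have "\<dots> = L / c * dist x y" by (simp add: exp_minus)
    also have "exp (- c * t) * norm (integral {0..t} (G x) - integral {0..t} (G y)) = dist (\<phi> x t) (\<phi> y t)"
      by (simp add: \<phi>_def dist_norm flip: scaleR_diff_right)
    finally show "dist (apply_bcontfun (\<Phi> x) t') (apply_bcontfun (\<Phi> y) t') \<le> L / c * dist x y"
      by (simp add: \<Phi> t_def)
  qed
  moreover have "0 \<le> L / c" "L / c < 1" using L_nonneg by (auto simp: c_def)
  ultimately obtain x where x: "\<Phi> x = x"
    using banach_fix_type[of "L / c" \<Phi>] by blast
  define p where "p t = exp (c * t) *\<^sub>R apply_bcontfun x t" for t
  have "((\<lambda>s. g (p s, u s)) has_integral p t - z) {0..t}" if "t \<ge> 0" for t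
  proof -
    have "apply_bcontfun x t = \<phi> x t" using \<Phi>[of x t] that by (simp add: x max_def)
    then have "p t = z + integral {0..t} (G x)"
      by (simp add: p_def \<phi>_def exp_minus)
    then show ?thesis
      using integrable_integral[OF Gint[of x t]] by (simp add: G_def[abs_def] p_def)
  qed
  then show ?thesis unfolding integral_solution_def by blast
qed

text \<open>Countably many trajectories that fit together form a trajectory: the control and the state on the
\<open>n\<close>-th block are those of the \<open>n\<close>-th piece. At a node the two adjacent controls may differ, which changes
the integrand at a single point only.\<close>

theorem integral_solution_concat:
  fixes l :: "nat \<Rightarrow> real"
  assumes pos: "\<And>n. 0 < l n" and unb: "\<And>x. \<exists>n. x < (\<Sum>i<n. l i)"
    and u: "\<And>n. u n \<in> controls" and q: "\<And>n. integral_solution g (u n) (z n) (q n)"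
    and join: "\<And>n. q n (l n) = z (Suc n)"
  obtains v r where "v \<in> controls" "integral_solution g v (z 0) r"
    "\<And>n t. 0 \<le> t \<Longrightarrow> t \<le> l n \<Longrightarrow> r ((\<Sum>i<n. l i) + t) = q n t"
proof -
  define S where "S n = (\<Sum>i<n. l i)" for n
  define v where "v t = u (stage l t) (t - S (stage l t))" for t
  define r where "r t = q (stage l t) (t - S (stage l t))" for t
  have S_Suc: "S (Suc n) = S n + l n" for n by (simp add: S_def)
  have S0: "S n \<ge> 0" for n unfolding S_def using pos by (intro sum_nonneg) (auto intro: less_imp_le)
  have st: "stage l (S n + t) = n" if "0 \<le> t" "t < l n" for n t
    by (rule stage_eq[OF pos]) (use that in \<open>auto simp: S_def\<close>)
  have v_eq: "v (S n + t) = u n t" if "0 \<le> t" "t < l n" for n t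
    using st[OF that] by (simp add: v_def)
  have r_eq': "r (S n + t) = q n t" if "0 \<le> t" "t < l n" for n t
    using st[OF that] by (simp add: r_def)
  have r_eq: "r (S n + t) = q n t" if "0 \<le> t" "t \<le> l n" for n t
  proof (cases "t < l n")
    case False
    then have "t = l n" using that by simp
    then have "r (S n + t) = r (S (Suc n) + 0)" by (simp add: S_Suc)
    also have "\<dots> = q (Suc n) 0" using pos by (intro r_eq') auto
    also have "\<dots> = q n t" using join \<open>t = l n\<close> integral_solution_start[OF q] by simp
    finally show ?thesis .
  qed (use r_eq' that in auto)
  have "v \<in> controls"
  proof -
    let ?u = "\<lambda>n t. if t \<in> {0..} then u n t else u n 0"
    have "(\<lambda>t. ?u (stage l t) (- S (stage l t) + t)) \<in> borel_measurable lebesgue"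
    proof (rule measurable_compose_countable[where f = "\<lambda>n t. ?u n (- S n + t)"])
      show "(\<lambda>t. ?u n (- S n + t)) \<in> borel_measurable lebesgue" for n
        using u controls_iff_extension
        by (intro measurable_compose[OF translation_lebesgue_measurable]) blast
      show "stage l \<in> lebesgue \<rightarrow>\<^sub>M count_space UNIV"
        unfolding stage_def by (intro measurable_Least measurable_completion) measurable
    qed
    then have "(\<lambda>t. ?u (stage l t) (- S (stage l t) + t)) \<in> borel_measurable (lebesgue_on {0..})"
      by (rule measurable_restrict_space1)
    also have "?this \<longleftrightarrow> v \<in> borel_measurable (lebesgue_on {0..})"
      by (rule measurable_cong) (use stage_exists(1)[OF pos unb] in \<open>auto simp: v_def S_def\<close>)
    finally show ?thesis by (simp add: controls_def)
  qed
  have piece: "((\<lambda>s. g (r s, v s)) has_integral q n t - z n) {S n..S n + t}"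
    if "0 \<le> t" "t \<le> l n" for n t
  proof -
    have "((\<lambda>s. g (r (S n + s), v (S n + s))) has_integral q n t - z n) {0..t}"
    proof (rule has_integral_spike_finite[of "{t}"])
      show "((\<lambda>s. g (q n s, u n s)) has_integral q n t - z n) {0..t}"
        using q[of n] that by (simp add: integral_solution_def)
      show "g (r (S n + s), v (S n + s)) = g (q n s, u n s)" if "s \<in> {0..t} - {t}" for s
        using that \<open>t \<le> l n\<close> v_eq[of s n] r_eq[of s n] by auto
    qed simp
    then show ?thesis
      using has_integral_translate[of "\<lambda>s. g (r s, v s)" "S n"] by simp
  qed
  have upto: "((\<lambda>s. g (r s, v s)) has_integral z n - z 0) {0..S n}" for n
  proof (induction n)
    case 0 show ?case using has_integral_refl(2)[of "\<lambda>s. g (r s, v s)" 0] by (simp add: S_def)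
  next
    case (Suc n)
    have "((\<lambda>s. g (r s, v s)) has_integral (z n - z 0) + (q n (l n) - z n)) {0..S (Suc n)}"
    proof (rule has_integral_combine[OF _ _ Suc.IH])
      show "((\<lambda>s. g (r s, v s)) has_integral q n (l n) - z n) {S n..S (Suc n)}"
        using piece[of "l n" n] pos[of n] by (simp add: S_Suc)
    qed (use S0 pos[of n] in \<open>auto simp: S_Suc\<close>)
    then show ?case by (simp add: join)
  qed
  have "integral_solution g v (z 0) r"
    unfolding integral_solution_def
  proof (intro allI impI)
    fix t :: real assume "0 \<le> t"
    define n where "n = stage l t"
    define s where "s = t - S n"
    have s: "0 \<le> s" "s \<le> l n" "t = S n + s"
      using stage_exists[OF pos unb \<open>0 \<le> t\<close>] S_Suc[of n] by (auto simp: s_def n_def S_def)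
    have "((\<lambda>s. g (r s, v s)) has_integral (z n - z 0) + (q n s - z n)) {0..t}"
      by (rule has_integral_combine[OF _ _ upto]) (use piece[OF s(1,2)] s S0 in auto)
    moreover have "r t = q n s" using r_eq[OF s(1,2)] s(3) by simp
    ultimately show "((\<lambda>s. g (r s, v s)) has_integral r t - z 0) {0..t}" by simp
  qed
  then show ?thesis
    using that \<open>v \<in> controls\<close> r_eq by (simp add: S_def)
qed

end

section \<open>Following a trajectory by piecewise constant controls\<close>

context control_system
begin

text \<open>Expand \<open>|p(t) - q(t)|\<^sup>2\<close> around the initial difference \<open>x - y\<close>. The linear term is the integral of
\<open>\<langle>x - y, g(p, u) - g(q, v)\<rangle>\<close>, where replacing the moving states by \<open>x\<close> and \<open>y\<close> costs \<open>O(t)\<close> by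
Lipschitz continuity and leaves a quantity that the choice of \<open>v\<close> bounds by \<open>e\<close>. All remaining terms are
of second order in \<open>t\<close>, with a constant independent of \<open>x\<close> and \<open>y\<close>.\<close>

lemma frozen_direction_step:
  assumes p: "integral_solution g u x p" and q: "integral_solution g (\<lambda>_. v) y q"
    and R: "\<And>t. t \<ge> 0 \<Longrightarrow> norm (p t) \<le> R" "\<And>t. t \<ge> 0 \<Longrightarrow> norm (q t) \<le> R"
    and v: "\<And>w. (x - y) \<bullet> (g (x, w) - g (y, v)) \<le> e"
    and "t \<ge> 0"
  defines "C \<equiv> a * (1 + R)"
  shows "(norm (p t - q t))\<^sup>2 \<le> (norm (x - y))\<^sup>2 + 2 * e * t + (8 * R * L * C + 4 * C\<^sup>2) * t\<^sup>2"
proof -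
  note p0 = integral_solution_start[OF p] and q0 = integral_solution_start[OF q]
  have "R \<ge> 0" using order_trans[OF norm_ge_zero R(1)[of 0]] by simp
  then have "C \<ge> 0" using a_pos by (simp add: C_def)
  have sp: "norm (p s - x) \<le> C * s" and sq: "norm (q s - y) \<le> C * s" if "s \<ge> 0" for s
    using integral_solution_speed[OF p order_refl that, of R] integral_solution_speed[OF q order_refl that, of R] R p0 q0
    by (simp_all add: C_def)
  define b where "b = (p t - x) - (q t - y)"
  have "norm b \<le> 2 * C * t"
    using norm_triangle_ineq4[of "p t - x" "q t - y"] sp[OF \<open>t \<ge> 0\<close>] sq[OF \<open>t \<ge> 0\<close>] by (simp add: b_def)
  then have b2: "(norm b)\<^sup>2 \<le> (2 * C * t)\<^sup>2" by (intro power_mono) auto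
  have int: "((\<lambda>s. (x - y) \<bullet> (g (p s, u s) - g (q s, v))) has_integral (x - y) \<bullet> b) {0..t}"
  proof -
    have "((\<lambda>s. g (p s, u s) - g (q s, v)) has_integral b) {0..t}"
      unfolding b_def using p q \<open>t \<ge> 0\<close>
      by (intro has_integral_diff) (auto simp: integral_solution_def)
    from has_integral_linear[OF this bounded_linear_inner_right[of "x - y"]]
    show ?thesis by (simp add: o_def)
  qed
  have xy: "norm (x - y) \<le> 2 * R"
    using norm_triangle_ineq4[of x y] R[of 0] p0 q0 by simp
  have "(x - y) \<bullet> b \<le> t * (e + 4 * R * L * C * t)"
  proof (rule has_integral_le[OF int])
    show "((\<lambda>s. e + 4 * R * L * C * t) has_integral t * (e + 4 * R * L * C * t)) {0..t}"
      using has_integral_const_real[of "e + 4 * R * L * C * t" 0 t] \<open>t \<ge> 0\<close> by simp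
    fix s assume s: "s \<in> {0..t}"
    define d where "d = (g (p s, u s) - g (x, u s)) - (g (q s, v) - g (y, v))"
    have "norm d \<le> norm (g (p s, u s) - g (x, u s)) + norm (g (q s, v) - g (y, v))"
      unfolding d_def by (rule norm_triangle_ineq4)
    also have "\<dots> \<le> L * norm (p s - x) + L * norm (q s - y)"
      by (intro add_mono g_lipschitz)
    also have "\<dots> \<le> L * (C * t) + L * (C * t)"
      using sp[of s] sq[of s] s \<open>C \<ge> 0\<close> L_nonneg
      by (intro add_mono mult_left_mono) (auto intro: order_trans mult_left_mono)
    finally have "norm d \<le> 2 * L * C * t" by (simp add: mult_ac)
    then have "norm (x - y) * norm d \<le> (2 * R) * (2 * L * C * t)"
      using xy \<open>R \<ge> 0\<close> by (intro mult_mono) auto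
    then have "(x - y) \<bullet> d \<le> 4 * R * L * C * t"
      using norm_cauchy_schwarz[of "x - y" d] by simp
    moreover have "(x - y) \<bullet> (g (p s, u s) - g (q s, v)) = (x - y) \<bullet> (g (x, u s) - g (y, v)) + (x - y) \<bullet> d"
      by (simp add: d_def inner_diff_right)
    ultimately show "(x - y) \<bullet> (g (p s, u s) - g (q s, v)) \<le> e + 4 * R * L * C * t"
      using v[of "u s"] by linarith
  qed
  moreover have "(norm (p t - q t))\<^sup>2 = (norm (x - y))\<^sup>2 + 2 * ((x - y) \<bullet> b) + (norm b)\<^sup>2"
  proof -
    have "p t - q t = (x - y) + b" by (simp add: b_def)
    then show ?thesis by (simp add: power2_norm_eq_inner inner_add_left inner_add_right inner_commute)
  qed
  ultimately show ?thesis using b2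
    by (simp add: algebra_simps power2_eq_square)
qed

text \<open>The answering control is constant on steps of length \<open>l n = c/(n + 1)\<close>, chosen at the beginning of each
step with error \<open>l n\<close>. The steps sum to infinity while their squares have the finite sum \<open>c\<^sup>2 \<sigma>\<close>, so the
squared distance grows by at most \<open>K c\<^sup>2 \<sigma> = \<epsilon>\<^sup>2\<close> over the whole half-line.\<close>

theorem nonexpansive_response:
  assumes inv: "\<And>z u p t. z \<in> G \<Longrightarrow> u \<in> controls \<Longrightarrow> integral_solution g u z p \<Longrightarrow> t \<ge> 0 \<Longrightarrow> p t \<in> G"
    and bdd: "\<And>z. z \<in> G \<Longrightarrow> norm z \<le> R"
    and dissip: "\<And>x y e. x \<in> G \<Longrightarrow> y \<in> G \<Longrightarrow> e > 0 \<Longrightarrow> \<exists>v. \<forall>w. (x - y) \<bullet> (g (x, w) - g (y, v)) \<le> e"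
    and z: "z \<in> G" "z' \<in> G" and u: "u \<in> controls" and p: "integral_solution g u z p" and "\<epsilon> > 0"
  shows "\<exists>v\<in>controls. \<exists>q. integral_solution g v z' q \<and> (\<forall>t\<ge>0. dist (p t) (q t) \<le> dist z z' + \<epsilon>)"
proof -
  define C where "C = a * (1 + R)"
  \<comment> \<open>The second order constant of a step, plus 2 for the error \<open>l n\<close> in the choice of the constant control.\<close>
  define K where "K = 8 * R * L * C + 4 * C\<^sup>2 + 2"
  have "R \<ge> 0" using order_trans[OF norm_ge_zero bdd[OF z(1)]] .
  then have "K > 0" using a_pos L_nonneg by (simp add: K_def C_def add_nonneg_pos)
  define \<sigma> where "\<sigma> = (\<Sum>n. (inverse (real (Suc n)))\<^sup>2)"
  have summ: "summable (\<lambda>n. (inverse (real (Suc n)))\<^sup>2)"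
    using inverse_power_summable[of 2, where 'a = real] summable_Suc_iff[of "\<lambda>n. inverse (real n ^ 2)"]
    by (simp add: power_inverse)
  have part: "(\<Sum>i<n. (inverse (real (Suc i)))\<^sup>2) \<le> \<sigma>" for n
    unfolding \<sigma>_def by (rule sum_le_suminf[OF summ]) auto
  have "\<sigma> > 0" using part[of 1] by simp
  define c where "c = \<epsilon> / sqrt (K * \<sigma>)"
  have "c > 0" using \<open>\<epsilon> > 0\<close> \<open>K > 0\<close> \<open>\<sigma> > 0\<close> by (simp add: c_def)
  have cK: "K * (c\<^sup>2 * \<sigma>) = \<epsilon>\<^sup>2"
    using \<open>K > 0\<close> \<open>\<sigma> > 0\<close> by (simp add: c_def power_divide)
  define l where "l n = c * inverse (real (Suc n))" for n
  have lpos: "l n > 0" for n using \<open>c > 0\<close> by (simp add: l_def)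
  define S where "S n = (\<Sum>i<n. l i)" for n
  have S0: "S n \<ge> 0" for n unfolding S_def using lpos by (intro sum_nonneg) (auto intro: less_imp_le)
  have unb: "\<exists>n. x < (\<Sum>i<n. l i)" for x
  proof -
    have "filterlim (\<lambda>n. c * harm n :: real) at_top sequentially"
      using \<open>c > 0\<close> by (intro filterlim_tendsto_pos_mult_at_top[OF tendsto_const] harm_at_top) auto
    then have "eventually (\<lambda>n. x < c * harm n) sequentially"
      by (simp add: filterlim_at_top_dense)
    then obtain n where "x < c * harm n" by (auto simp: eventually_sequentially)
    moreover have "c * harm n = (\<Sum>i<n. l i)"
      by (simp add: harm_def l_def sum_distrib_left sum.atLeast1_atMost_eq)
    ultimately show ?thesis by auto
  qed
  \<comment> \<open>A step: its initial state, its constant control and the trajectory that this control generates.\<close>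
  define ok where "ok n s \<longleftrightarrow> (case s of (y, v, q) \<Rightarrow> y \<in> G \<and> integral_solution g (\<lambda>_. v) y q \<and>
      (\<forall>w. (p (S n) - y) \<bullet> (g (p (S n), w) - g (y, v)) \<le> l n))" for n and s :: "'a \<times> 'u \<times> (real \<Rightarrow> 'a)"
  have pG: "p t \<in> G" if "t \<ge> 0" for t by (rule inv[OF z(1) u p that])
  have start: "\<exists>v q. ok n (y, v, q)" if y: "y \<in> G" for n y
  proof -
    obtain v where "\<forall>w. (p (S n) - y) \<bullet> (g (p (S n), w) - g (y, v)) \<le> l n"
      using dissip[OF pG[OF S0] y lpos] by blast
    moreover obtain q where "integral_solution g (\<lambda>_. v) y q"
      using integral_solution_exists[OF controls_const] by blast
    ultimately show ?thesis using y by (auto simp: ok_def)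
  qed
  have "\<exists>f. \<forall>n. ((n = 0 \<longrightarrow> fst (f n) = z') \<and> ok n (f n)) \<and> fst (f (Suc n)) = snd (snd (f n)) (l n)"
  proof (rule dependent_nat_choice)
    show "\<exists>s. (0 = (0::nat) \<longrightarrow> fst s = z') \<and> ok 0 s"
      using start[OF z(2), of 0] by (metis fst_conv)
  next
    fix s n assume "(n = 0 \<longrightarrow> fst s = z') \<and> ok n s"
    then have "ok n s" by blast
    moreover obtain y v q where s: "s = (y, v, q)" by (cases s)
    ultimately have "q (l n) \<in> G"
      using inv[OF _ controls_const] lpos[of n] by (auto simp: ok_def intro: less_imp_le)
    then show "\<exists>s'. ((Suc n = 0 \<longrightarrow> fst s' = z') \<and> ok (Suc n) s') \<and> fst s' = snd (snd s) (l n)"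
      using start[of "q (l n)" "Suc n"] s by (metis fst_conv snd_conv nat.distinct(1))
  qed
  then obtain f where f: "fst (f 0) = z'" "\<And>n. ok n (f n)"
    "\<And>n. fst (f (Suc n)) = snd (snd (f n)) (l n)" by blast
  define y v q where "y n = fst (f n)" and "v n = fst (snd (f n))" and "q n = snd (snd (f n))" for n
  have y: "y n \<in> G" and q: "integral_solution g (\<lambda>_. v n) (y n) (q n)"
    and v: "\<And>w. (p (S n) - y n) \<bullet> (g (p (S n), w) - g (y n, v n)) \<le> l n" for n
    using f(2)[of n] by (auto simp: ok_def y_def v_def q_def split: prod.splits)
  have join: "q n (l n) = y (Suc n)" for n using f(3) by (simp add: y_def q_def)
  have "y 0 = z'" using f(1) by (simp add: y_def)
  obtain w r where w: "w \<in> controls" and r: "integral_solution g w (y 0) r"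
    and rq: "\<And>n t. 0 \<le> t \<Longrightarrow> t \<le> l n \<Longrightarrow> r ((\<Sum>i<n. l i) + t) = q n t"
    using integral_solution_concat[of l "\<lambda>n _. v n" y q, OF lpos unb controls_const q join] by blast
  have step: "(norm (p (S n + t) - q n t))\<^sup>2 \<le> (norm (p (S n) - y n))\<^sup>2 + K * (l n)\<^sup>2"
    if t: "0 \<le> t" "t \<le> l n" for n t
  proof -
    have "(norm (p (S n + t) - q n t))\<^sup>2
        \<le> (norm (p (S n) - y n))\<^sup>2 + 2 * l n * t + (8 * R * L * C + 4 * C\<^sup>2) * t\<^sup>2"
      unfolding C_def
    proof (rule frozen_direction_step[OF integral_solution_shift[OF p S0] q _ _ v t(1)])
      show "norm (p (S n + s)) \<le> R" if "s \<ge> 0" for s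
        using bdd[OF pG] S0[of n] that by simp
      show "norm (q n s) \<le> R" if "s \<ge> 0" for s
        using bdd[OF inv[OF y controls_const q that]] .
    qed
    also have "\<dots> \<le> (norm (p (S n) - y n))\<^sup>2 + 2 * l n * l n + (8 * R * L * C + 4 * C\<^sup>2) * (l n)\<^sup>2"
      using t lpos[of n] \<open>R \<ge> 0\<close> L_nonneg a_pos
      by (intro add_mono mult_left_mono power_mono order_refl) (auto simp: C_def)
    also have "\<dots> = (norm (p (S n) - y n))\<^sup>2 + K * (l n)\<^sup>2"
      by (simp add: K_def algebra_simps power2_eq_square)
    finally show ?thesis .
  qed
  have nodes: "(norm (p (S n) - y n))\<^sup>2 \<le> (dist z z')\<^sup>2 + K * (\<Sum>i<n. (l i)\<^sup>2)" for n
  proof (induction n)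
    case 0
    then show ?case using integral_solution_start[OF p] \<open>y 0 = z'\<close> by (simp add: S_def dist_norm)
  next
    case (Suc n)
    have "(norm (p (S (Suc n)) - y (Suc n)))\<^sup>2 \<le> (norm (p (S n) - y n))\<^sup>2 + K * (l n)\<^sup>2"
      using step[of "l n" n] lpos[of n] join[of n] by (simp add: S_def)
    then show ?case using Suc.IH by (simp add: algebra_simps)
  qed
  have sq: "K * (\<Sum>i<n. (l i)\<^sup>2) \<le> \<epsilon>\<^sup>2" for n
  proof -
    have "(\<Sum>i<n. (l i)\<^sup>2) = c\<^sup>2 * (\<Sum>i<n. (inverse (real (Suc i)))\<^sup>2)"
      by (simp add: l_def power_mult_distrib sum_distrib_left)
    also have "\<dots> \<le> c\<^sup>2 * \<sigma>" by (intro mult_left_mono part) simp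
    finally have "K * (\<Sum>i<n. (l i)\<^sup>2) \<le> K * (c\<^sup>2 * \<sigma>)"
      using \<open>K > 0\<close> by (intro mult_left_mono) auto
    then show ?thesis using cK by simp
  qed
  have "dist (p t) (r t) \<le> dist z z' + \<epsilon>" if "t \<ge> 0" for t
  proof -
    define n where "n = stage l t"
    define s where "s = t - S n"
    have s: "0 \<le> s" "s \<le> l n" "t = S n + s"
      using stage_exists[OF lpos unb that] by (auto simp: s_def n_def S_def)
    have "(dist (p t) (r t))\<^sup>2 = (norm (p (S n + s) - q n s))\<^sup>2"
      using rq[OF s(1,2)] s(3) by (simp add: dist_norm S_def)
    also have "\<dots> \<le> (norm (p (S n) - y n))\<^sup>2 + K * (l n)\<^sup>2" by (rule step[OF s(1,2)])
    also have "\<dots> \<le> (dist z z')\<^sup>2 + K * (\<Sum>i<Suc n. (l i)\<^sup>2)"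
      using nodes[of n] by (simp add: algebra_simps)
    also have "\<dots> \<le> (dist z z')\<^sup>2 + \<epsilon>\<^sup>2" using sq[of "Suc n"] by simp
    also have "\<dots> \<le> (dist z z' + \<epsilon>)\<^sup>2" using \<open>\<epsilon> > 0\<close> by (simp add: power2_sum)
    finally show ?thesis using \<open>\<epsilon> > 0\<close> by (simp add: power2_le_iff_abs_le)
  qed
  then show ?thesis using w r \<open>y 0 = z'\<close> by blast
qed

end

section \<open>Values of nonexpansive families of plays\<close>

text \<open>The properties of a control problem that its asymptotic values depend on: \<open>P z\<close> is the set of paths
available from \<open>z\<close> and \<open>k\<close> is the running cost. Concatenation is required for countably many pieces since
near-optimal play for the uniform value, unlike that for a finite horizon, has infinitely many stages.\<close>

locale nonexpansive_plays =
  fixes G :: "'a::metric_space set" and P :: "'a \<Rightarrow> (real \<Rightarrow> 'a) set"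
    and k :: "'a \<Rightarrow> real" and B :: real
  assumes finite_net: "e > 0 \<Longrightarrow> \<exists>F. finite F \<and> F \<subseteq> G \<and> G \<subseteq> (\<Union>f\<in>F. ball f e)"
    and k_bound: "z \<in> G \<Longrightarrow> \<bar>k z\<bar> \<le> B"
    and k_uniformly_continuous: "uniformly_continuous_on G k"
    and B_nonneg: "0 \<le> B"
    and plays_nonempty: "z \<in> G \<Longrightarrow> P z \<noteq> {}"
    and play_start: "z \<in> G \<Longrightarrow> p \<in> P z \<Longrightarrow> p 0 = z"
    and play_in: "z \<in> G \<Longrightarrow> p \<in> P z \<Longrightarrow> 0 \<le> t \<Longrightarrow> p t \<in> G"
    and play_continuous: "z \<in> G \<Longrightarrow> p \<in> P z \<Longrightarrow> continuous_on {0..} p"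
    and play_shift: "z \<in> G \<Longrightarrow> p \<in> P z \<Longrightarrow> 0 \<le> s \<Longrightarrow> (\<lambda>t. p (s + t)) \<in> P (p s)"
    and play_concat: "\<And>(l :: nat \<Rightarrow> real) x q. (\<And>n. 0 < l n) \<Longrightarrow> (\<And>c. \<exists>n. c < (\<Sum>i<n. l i)) \<Longrightarrow>
        (\<And>n. x n \<in> G) \<Longrightarrow> (\<And>n. q n \<in> P (x n)) \<Longrightarrow> (\<And>n. q n (l n) = x (Suc n)) \<Longrightarrow>
        \<exists>r\<in>P (x 0). \<forall>n. \<forall>t\<in>{0..l n}. r ((\<Sum>i<n. l i) + t) = q n t"
    and nonexpansive: "z \<in> G \<Longrightarrow> z' \<in> G \<Longrightarrow> p \<in> P z \<Longrightarrow> e > 0 \<Longrightarrow>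
        \<exists>q\<in>P z'. \<forall>t\<ge>0. dist (p t) (q t) \<le> dist z z' + e"
begin

definition cost :: "(real \<Rightarrow> 'a) \<Rightarrow> real \<Rightarrow> real" where
  "cost p t = integral {0..t} (\<lambda>s. k (p s))"

abbreviation tail :: "(real \<Rightarrow> 'a) \<Rightarrow> real \<Rightarrow> real \<Rightarrow> 'a" where
  "tail p m \<equiv> \<lambda>s. p (m + s)"

definition V :: "real \<Rightarrow> real \<Rightarrow> 'a \<Rightarrow> real" where
  "V m t z = (INF p\<in>P z. cost (tail p m) t / t)"

definition Vinf :: "real \<Rightarrow> 'a \<Rightarrow> real" where
  "Vinf t z = (INF m\<in>{0..}. V m t z)"

definition Vstar :: "'a \<Rightarrow> real" where
  "Vstar z = (SUP t\<in>{0<..}. Vinf t z)"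

lemma k_integrable:
  assumes "z \<in> G" "p \<in> P z" "0 \<le> s"
  shows "(\<lambda>r. k (p r)) integrable_on {s..t}"
proof (rule integrable_continuous_interval, rule continuous_on_compose2[of G k])
  show "continuous_on G k" by (rule uniformly_continuous_imp_continuous[OF k_uniformly_continuous])
  show "continuous_on {s..t} p" by (rule continuous_on_subset[OF play_continuous[OF assms(1,2)]]) (use assms in auto)
  show "p ` {s..t} \<subseteq> G" using play_in[OF assms(1,2)] assms(3) by auto
qed

lemma play_tail: "z \<in> G \<Longrightarrow> p \<in> P z \<Longrightarrow> 0 \<le> s \<Longrightarrow> p s \<in> G \<and> tail p s \<in> P (p s)"
  using play_in play_shift by blast

lemma cost_shift:
  assumes "z \<in> G" "p \<in> P z" "0 \<le> m" "0 \<le> t"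
  shows "cost p (m + t) = cost p m + cost (tail p m) t"
proof -
  have "((\<lambda>r. k (p r)) has_integral integral {m..m + t} (\<lambda>r. k (p r))) {m + 0..m + t}"
    using k_integrable[OF assms(1-3)] by (simp add: integrable_integral)
  then have "((\<lambda>r. k (p (m + r))) has_integral integral {m..m + t} (\<lambda>r. k (p r))) {0..t}"
    by (simp only: has_integral_translate[of "\<lambda>r. k (p r)"])
  then have "cost (tail p m) t = integral {m..m + t} (\<lambda>r. k (p r))"
    unfolding cost_def by (rule integral_unique)
  moreover have "integral {0..m} (\<lambda>r. k (p r)) + integral {m..m + t} (\<lambda>r. k (p r)) = cost p (m + t)"
    unfolding cost_def
    by (rule Henstock_Kurzweil_Integration.integral_combine) (use assms k_integrable in auto)
  ultimately show ?thesis by (simp add: cost_def)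
qed

lemma cost_near:
  assumes "z \<in> G" "p \<in> P z" "z' \<in> G" "q \<in> P z'" "0 \<le> t"
    and "\<And>s. 0 \<le> s \<Longrightarrow> k (p s) \<le> k (q s) + e"
  shows "cost p t \<le> cost q t + t * e"
proof -
  have p: "(\<lambda>s. k (p s)) integrable_on {0..t}" and q: "(\<lambda>s. k (q s)) integrable_on {0..t}"
    using k_integrable[OF assms(1,2)] k_integrable[OF assms(3,4)] by auto
  have "cost p t \<le> integral {0..t} (\<lambda>s. k (q s) + e)"
    unfolding cost_def
    by (rule integral_le[OF p integrable_add[OF q integrable_const_ivl]]) (use assms(6) in auto)
  also have "\<dots> = cost q t + t * e"
    unfolding cost_def using integral_add[OF q integrable_const_ivl, of e] assms(5) by simp
  finally show ?thesis .
qed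

lemma cost_cong: "(\<And>s. 0 \<le> s \<Longrightarrow> s \<le> t \<Longrightarrow> p s = q s) \<Longrightarrow> cost p t = cost q t"
  unfolding cost_def by (rule integral_cong) auto

lemma cost_bound:
  assumes "z \<in> G" "p \<in> P z" "0 \<le> t"
  shows "\<bar>cost p t\<bar> \<le> t * B"
proof -
  have "norm (cost p t) \<le> integral {0..t} (\<lambda>_. B)"
    unfolding cost_def
    by (rule integral_norm_bound_integral)
      (use assms k_integrable k_bound play_in in auto)
  then show ?thesis using assms by simp
qed

text \<open>Countable concatenation specialises to two pieces by cutting the second one into pieces of length 1.\<close>

lemma concat_two:
  assumes z: "z \<in> G" and p: "p \<in> P z" and s: "0 \<le> s" and q: "q \<in> P (p s)"
  obtains r where "r \<in> P z" "\<And>t. 0 \<le> t \<Longrightarrow> t \<le> s \<Longrightarrow> r t = p t" "\<And>t. 0 \<le> t \<Longrightarrow> r (s + t) = q t"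
proof (cases "s = 0")
  case True
  then show ?thesis using that[of q] q play_start[OF z p] play_start[of z q] z
    by (metis add_0 antisym)
next
  case False
  have psG: "p s \<in> G" using play_in[OF z p s] .
  define l where "l n = (if n = 0 then s else 1)" for n :: nat
  define x where "x n = (if n = 0 then z else q (real (n - 1)))" for n
  define f where "f n = (if n = 0 then p else tail q (real (n - 1)))" for n
  have S: "(\<Sum>i<Suc n. l i) = s + real n" for n
    by (induction n) (auto simp: l_def)
  have unb: "\<exists>n. c < (\<Sum>i<n. l i)" for c
  proof -
    obtain n where "c < real n" using reals_Archimedean2 by blast
    then show ?thesis using S[of n] s by (intro exI[of _ "Suc n"]) linarith
  qed
  have "\<exists>r\<in>P (x 0). \<forall>n. \<forall>t\<in>{0..l n}. r ((\<Sum>i<n. l i) + t) = f n t"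
  proof (rule play_concat[OF _ unb])
    show "0 < l n" for n using False s by (simp add: l_def)
    show "x n \<in> G" for n using z play_in[OF psG q] by (simp add: x_def)
    show "f n \<in> P (x n)" for n using p play_shift[OF psG q] by (simp add: x_def f_def)
    show "f n (l n) = x (Suc n)" for n
      using play_start[OF psG q] by (cases n) (simp_all add: l_def x_def f_def add.commute)
  qed
  then obtain r where "r \<in> P (x 0)" and r: "\<And>n t. 0 \<le> t \<Longrightarrow> t \<le> l n \<Longrightarrow> r ((\<Sum>i<n. l i) + t) = f n t"
    by auto
  show ?thesis
  proof (rule that)
    show "r \<in> P z" using \<open>r \<in> P (x 0)\<close> by (simp add: x_def)
    show "r t = p t" if "0 \<le> t" "t \<le> s" for t using r[of t 0] that by (simp add: l_def f_def)
    fix t :: real assume t: "0 \<le> t"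
    define n where "n = nat \<lfloor>t\<rfloor>"
    have n: "real n \<le> t" "t - real n \<le> 1" using t by (auto simp: n_def; linarith)+
    have "r ((\<Sum>i<Suc n. l i) + (t - real n)) = f (Suc n) (t - real n)"
      by (rule r) (use n in \<open>auto simp: l_def\<close>)
    then show "r (s + t) = q t" unfolding S by (simp add: f_def)
  qed
qed

lemma concat_two_cost:
  assumes z: "z \<in> G" and p: "p \<in> P z" and s: "0 \<le> s" and q: "q \<in> P (p s)"
  shows "\<exists>r\<in>P z. (\<forall>t\<ge>0. cost r (s + t) = cost p s + cost q t) \<and>
    (\<forall>m\<ge>0. \<forall>t. cost (tail r (s + m)) t = cost (tail q m) t)"
proof -
  obtain r where r: "r \<in> P z" "\<And>t. 0 \<le> t \<Longrightarrow> t \<le> s \<Longrightarrow> r t = p t" "\<And>t. 0 \<le> t \<Longrightarrow> r (s + t) = q t"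
    using concat_two[OF assms] by blast
  show ?thesis
  proof (intro bexI[OF _ r(1)] conjI allI impI)
    fix t :: real assume t: "0 \<le> t"
    have "cost r (s + t) = cost r s + cost (tail r s) t" by (rule cost_shift[OF z r(1) s t])
    also have "cost r s = cost p s" by (rule cost_cong) (use r in auto)
    also have "cost (tail r s) t = cost q t" by (rule cost_cong) (use r in auto)
    finally show "cost r (s + t) = cost p s + cost q t" .
  next
    fix m t :: real assume "0 \<le> m"
    then show "cost (tail r (s + m)) t = cost (tail q m) t"
      by (intro cost_cong) (use r(3) in \<open>simp add: add.assoc\<close>)
  qed
qed

text \<open>Following a play closely enough changes the running cost by at most \<open>e\<close> at every date, hence every average
by at most \<open>e\<close>, whatever the horizon and the delay. This is the source of all equicontinuity below.\<close>

lemma shadow: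
  assumes "e > 0"
  obtains d where "d > 0"
    "\<And>z z' p. z \<in> G \<Longrightarrow> z' \<in> G \<Longrightarrow> dist z z' < d \<Longrightarrow> p \<in> P z \<Longrightarrow>
       \<exists>q\<in>P z'. \<forall>s\<ge>0. \<bar>k (p s) - k (q s)\<bar> \<le> e"
proof -
  obtain d where "d > 0" and d: "\<And>x y. x \<in> G \<Longrightarrow> y \<in> G \<Longrightarrow> dist y x < d \<Longrightarrow> dist (k y) (k x) < e"
    using k_uniformly_continuous \<open>e > 0\<close> unfolding uniformly_continuous_on_def by blast
  show ?thesis
  proof (rule that[of "d / 2"])
    fix z z' p assume as: "z \<in> G" "z' \<in> G" "dist z z' < d / 2" "p \<in> P z"
    obtain q where q: "q \<in> P z'" "\<And>t. t \<ge> 0 \<Longrightarrow> dist (p t) (q t) \<le> dist z z' + d / 2"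
      using nonexpansive[OF as(1,2,4), of "d/2"] \<open>d > 0\<close> by auto
    have "\<bar>k (p s) - k (q s)\<bar> \<le> e" if "s \<ge> 0" for s
      using d[of "q s" "p s"] play_in[OF as(2) q(1) that] play_in[OF as(1,4) that] q(2)[OF that] as(3)
      by (simp add: dist_real_def)
    then show "\<exists>q\<in>P z'. \<forall>s\<ge>0. \<bar>k (p s) - k (q s)\<bar> \<le> e" using q(1) by blast
  qed (use \<open>d > 0\<close> in simp)
qed

lemma mean_k_bound:
  assumes "z \<in> G" "p \<in> P z" "0 \<le> m" "0 < t"
  shows "\<bar>cost (tail p m) t / t\<bar> \<le> B"
  using cost_bound[of "p m" "tail p m" t] play_tail[OF assms(1-3)] assms(4)
  by (simp add: field_simps abs_mult)

lemma V_le: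
  assumes "z \<in> G" "p \<in> P z" "0 \<le> m" "0 < t"
  shows "t * V m t z \<le> cost (tail p m) t"
proof -
  have "V m t z \<le> cost (tail p m) t / t"
    unfolding V_def
  proof (rule cINF_lower[OF _ assms(2)])
    show "bdd_below ((\<lambda>p. cost (tail p m) t / t) ` P z)"
    proof (rule bdd_belowI2)
      fix p assume "p \<in> P z"
      then show "- B \<le> cost (tail p m) t / t"
        using abs_le_D2[OF mean_k_bound[OF assms(1) _ assms(3,4)], of p] by simp
    qed
  qed
  then show ?thesis using assms(4) by (simp add: field_simps)
qed

lemma V_ge:
  assumes "z \<in> G" "0 < t" and "\<And>p. p \<in> P z \<Longrightarrow> t * c \<le> cost (tail p m) t"
  shows "c \<le> V m t z"
  unfolding V_def
  by (rule cINF_greatest[OF plays_nonempty[OF assms(1)]]) (use assms(2,3) in \<open>simp add: field_simps\<close>)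

lemma V_attain:
  assumes "z \<in> G" "0 < t" "e > 0"
  obtains p where "p \<in> P z" "cost (tail p m) t \<le> t * (V m t z + e)"
proof -
  have "\<exists>p\<in>P z. \<not> t * (V m t z + e) \<le> cost (tail p m) t"
    using V_ge[OF assms(1,2), of "V m t z + e" m] assms(3) by fastforce
  then show ?thesis using that by fastforce
qed

lemma V_bound:
  assumes "z \<in> G" "0 \<le> m" "0 < t"
  shows "\<bar>V m t z\<bar> \<le> B"
proof -
  have bd: "\<bar>cost (tail p m) t\<bar> \<le> t * B" if "p \<in> P z" for p
    using cost_bound[of "p m" "tail p m" t] play_tail[OF assms(1) that assms(2)] assms(3) by simp
  obtain p where p: "p \<in> P z" using plays_nonempty[OF assms(1)] by blast
  have "t * V m t z \<le> t * B"
    using V_le[OF assms(1) p assms(2,3)] bd[OF p] by linarith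
  moreover have "- B \<le> V m t z"
  proof (rule V_ge[OF assms(1,3)])
    fix p assume "p \<in> P z"
    then show "t * - B \<le> cost (tail p m) t" using abs_le_D2[OF bd] by force
  qed
  ultimately show ?thesis using assms(3) by (simp add: abs_le_iff)
qed

lemma Vinf_le:
  assumes "z \<in> G" "0 < t" "0 \<le> m"
  shows "Vinf t z \<le> V m t z"
  unfolding Vinf_def
proof (rule cINF_lower)
  show "bdd_below ((\<lambda>m. V m t z) ` {0..})"
    using abs_le_D2[OF V_bound[OF assms(1) _ assms(2)]] by (intro bdd_belowI2[of _ "- B"]) force
qed (use assms in auto)

lemma Vinf_ge: "(\<And>m. 0 \<le> m \<Longrightarrow> c \<le> V m t z) \<Longrightarrow> c \<le> Vinf t z"
  unfolding Vinf_def by (rule cINF_greatest) auto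

lemma Vinf_bound:
  assumes "z \<in> G" "0 < t"
  shows "\<bar>Vinf t z\<bar> \<le> B"
proof -
  have "- B \<le> Vinf t z"
    by (rule Vinf_ge) (use V_bound[OF assms(1) _ assms(2)] in \<open>force simp: abs_le_iff\<close>)
  moreover have "Vinf t z \<le> B"
    using Vinf_le[OF assms order_refl] abs_le_D1[OF V_bound[OF assms(1) order_refl assms(2)]] by linarith
  ultimately show ?thesis by linarith
qed

lemma Vstar_ge:
  assumes "z \<in> G" "0 < t"
  shows "Vinf t z \<le> Vstar z"
  unfolding Vstar_def
proof (rule cSUP_upper)
  show "bdd_above ((\<lambda>t. Vinf t z) ` {0<..})"
    using abs_le_D1[OF Vinf_bound[OF assms(1)]] by (intro bdd_aboveI2[of _ _ B]) force
qed (use assms in auto)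

lemma Vstar_le: "(\<And>t. 0 < t \<Longrightarrow> Vinf t z \<le> c) \<Longrightarrow> Vstar z \<le> c"
  unfolding Vstar_def by (rule cSUP_least) auto

lemma Vstar_bound:
  assumes "z \<in> G"
  shows "\<bar>Vstar z\<bar> \<le> B"
proof -
  have "Vstar z \<le> B" by (rule Vstar_le) (use abs_le_D1[OF Vinf_bound[OF assms]] in force)
  moreover have "- B \<le> Vstar z" using Vstar_ge[OF assms zero_less_one] Vinf_bound[OF assms zero_less_one] by linarith
  ultimately show ?thesis by linarith
qed

lemma V_equicontinuous:
  assumes "e > 0"
  obtains d where "d > 0" "\<And>z z' m t. z \<in> G \<Longrightarrow> z' \<in> G \<Longrightarrow> dist z z' < d \<Longrightarrow> 0 \<le> m \<Longrightarrow> 0 < t \<Longrightarrow>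
     V m t z \<le> V m t z' + e"
proof -
  obtain d where "d > 0" and d: "\<And>z z' p. z \<in> G \<Longrightarrow> z' \<in> G \<Longrightarrow> dist z z' < d \<Longrightarrow> p \<in> P z \<Longrightarrow>
       \<exists>q\<in>P z'. \<forall>s\<ge>0. \<bar>k (p s) - k (q s)\<bar> \<le> e"
    using shadow[OF \<open>e > 0\<close>] by metis
  show ?thesis
  proof (rule that[OF \<open>d > 0\<close>])
    fix z z' and m t :: real assume as: "z \<in> G" "z' \<in> G" "dist z z' < d" "0 \<le> m" "0 < t"
    have "V m t z - e \<le> V m t z'"
    proof (rule V_ge[OF as(2,5)])
      fix p assume p: "p \<in> P z'"
      then obtain q where q: "q \<in> P z" "\<And>s. s \<ge> 0 \<Longrightarrow> \<bar>k (p s) - k (q s)\<bar> \<le> e"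
        using d[OF as(2,1)] as(3) by (auto simp: dist_commute)
      have "t * V m t z \<le> cost (tail q m) t" by (rule V_le[OF as(1) q(1) as(4,5)])
      also have "\<dots> \<le> cost (tail p m) t + t * e"
      proof (rule cost_near)
        show "q m \<in> G" "tail q m \<in> P (q m)" using play_tail[OF as(1) q(1) as(4)] by auto
        show "p m \<in> G" "tail p m \<in> P (p m)" using play_tail[OF as(2) p as(4)] by auto
        show "k (q (m + s)) \<le> k (p (m + s)) + e" if "0 \<le> s" for s
          using q(2)[of "m + s"] as(4) that by (simp add: abs_le_iff)
      qed (use as(5) in simp)
      finally show "t * (V m t z - e) \<le> cost (tail p m) t" by (simp add: algebra_simps)
    qed
    then show "V m t z \<le> V m t z' + e" by simp
  qed
qed

lemma Vstar_equicontinuous: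
  assumes V: "\<And>(m::real) (t::real). 0 \<le> m \<Longrightarrow> 0 < t \<Longrightarrow> V m t z \<le> V m t z' + e" and "z \<in> G" "z' \<in> G"
  shows "Vstar z \<le> Vstar z' + e"
proof (rule Vstar_le)
  fix t :: real assume t: "0 < t"
  have "Vinf t z - e \<le> Vinf t z'"
    by (rule Vinf_ge) (use Vinf_le[OF \<open>z \<in> G\<close> t] V[OF _ t] in \<open>force simp: algebra_simps\<close>)
  then show "Vinf t z \<le> Vstar z' + e" using Vstar_ge[OF \<open>z' \<in> G\<close> t] by simp
qed

text \<open>Take a finite net \<open>F\<close> of \<open>G\<close>. For each of the finitely many pairs \<open>(f, y)\<close> from \<open>F\<close> such that a play from
\<open>f\<close> comes near \<open>y\<close>, one hitting date is enough, so some \<open>M\<close> serves all pairs. An arbitrary \<open>z\<close> is near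
some \<open>f\<close>, and its plays follow those of \<open>f\<close> and conversely.\<close>

lemma bounded_time_reach:
  assumes "e > 0"
  obtains M where "M \<ge> 0"
    "\<And>z p t. z \<in> G \<Longrightarrow> p \<in> P z \<Longrightarrow> t \<ge> 0 \<Longrightarrow> \<exists>q\<in>P z. \<exists>m\<in>{0..M}. dist (p t) (q m) < e"
proof -
  define d where "d = e / 6"
  have "d > 0" using \<open>e > 0\<close> by (simp add: d_def)
  obtain F where F: "finite F" "F \<subseteq> G" "G \<subseteq> (\<Union>f\<in>F. ball f d)"
    using finite_net[OF \<open>d > 0\<close>] by blast
  define hit where "hit M f y \<longleftrightarrow> (\<exists>q\<in>P f. \<exists>m\<in>{0..M}. dist y (q m) < d)" for M f y
  have "eventually (\<lambda>M. \<forall>f\<in>F. \<forall>y\<in>F. (\<exists>p\<in>P f. \<exists>t\<ge>0. dist y (p t) < d) \<longrightarrow> hit M f y) at_top"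
  proof (intro eventually_ball_finite F(1) ballI)
    fix f y assume "f \<in> F" "y \<in> F"
    show "eventually (\<lambda>M. (\<exists>p\<in>P f. \<exists>t\<ge>0. dist y (p t) < d) \<longrightarrow> hit M f y) at_top"
    proof (cases "\<exists>p\<in>P f. \<exists>t\<ge>0. dist y (p t) < d")
      case True
      then obtain p t where "p \<in> P f" "t \<ge> 0" "dist y (p t) < d" by blast
      then show ?thesis
        by (intro eventually_mono[OF eventually_ge_at_top[of t]]) (fastforce simp: hit_def)
    next
      case False
      then show ?thesis by (intro always_eventually) blast
    qed
  qed
  then have "eventually (\<lambda>M. M \<ge> 0 \<and> (\<forall>f\<in>F. \<forall>y\<in>F. (\<exists>p\<in>P f. \<exists>t\<ge>0. dist y (p t) < d) \<longrightarrow> hit M f y)) at_top"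
    using eventually_ge_at_top[of "0::real"] by eventually_elim auto
  from eventually_happens'[OF trivial_limit_at_top_linorder this]
  obtain M where "M \<ge> 0"
    and M: "\<And>f y p t. f \<in> F \<Longrightarrow> y \<in> F \<Longrightarrow> p \<in> P f \<Longrightarrow> t \<ge> 0 \<Longrightarrow> dist y (p t) < d \<Longrightarrow> hit M f y"
    by blast
  show ?thesis
  proof (rule that[OF \<open>M \<ge> 0\<close>])
    fix z p t assume z: "z \<in> G" and p: "p \<in> P z" and t: "t \<ge> (0::real)"
    obtain f where f: "f \<in> F" "dist f z < d" using F(3) z by auto
    then have "f \<in> G" using F(2) by blast
    obtain p' where p': "p' \<in> P f" "\<And>t. t \<ge> 0 \<Longrightarrow> dist (p t) (p' t) \<le> dist z f + d"
      using nonexpansive[OF z \<open>f \<in> G\<close> p \<open>d > 0\<close>] by blast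
    obtain y where y: "y \<in> F" "dist y (p' t) < d"
      using F(3) play_in[OF \<open>f \<in> G\<close> p'(1) t] by auto
    obtain q' m where q': "q' \<in> P f" "m \<in> {0..M}" "dist y (q' m) < d"
      using M[OF f(1) y(1) p'(1) t y(2)] by (auto simp: hit_def)
    obtain q where q: "q \<in> P z" "\<And>t. t \<ge> 0 \<Longrightarrow> dist (q' t) (q t) \<le> dist f z + d"
      using nonexpansive[OF \<open>f \<in> G\<close> z q'(1) \<open>d > 0\<close>] by blast
    have 1: "dist (p t) (p' t) < 2 * d" using p'(2)[OF t] f(2) by (simp add: dist_commute)
    have 2: "dist (q' m) (q m) < 2 * d" using q(2)[of m] q'(2) f(2) by simp
    have 3: "dist (p t) (q m) \<le> dist (p t) (p' t) + dist (p' t) y + dist y (q' m) + dist (q' m) (q m)"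
      using dist_triangle[of "p t" "q m" "p' t"] dist_triangle[of "p' t" "q m" y] dist_triangle[of y "q m" "q' m"]
      by linarith
    have "dist (p' t) y < d" using y(2) by (simp add: dist_commute)
    then have "dist (p t) (q m) < e" using 1 2 3 q'(3) by (simp add: d_def)
    then show "\<exists>q\<in>P z. \<exists>m\<in>{0..M}. dist (p t) (q m) < e" using q(1) q'(2) by blast
  qed
qed

text \<open>A date \<open>m\<close>, however late, can be traded for a date \<open>m' \<le> M\<close>: approach \<open>p m\<close> within bounded time, then
follow the rest of \<open>p\<close>. The time spent approaching costs at most \<open>M B\<close>, whatever the horizon.\<close>

lemma bounded_delay:
  assumes "e > 0"
  obtains M where "M \<ge> 0"
    "\<And>z p m. z \<in> G \<Longrightarrow> p \<in> P z \<Longrightarrow> m \<ge> 0 \<Longrightarrow>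
      \<exists>r\<in>P z. \<exists>m'\<in>{0..M}. \<forall>t\<ge>0. cost r (m' + t) \<le> cost (tail p m) t + t * e + M * B"
proof -
  obtain d where "d > 0" and d: "\<And>z z' p. z \<in> G \<Longrightarrow> z' \<in> G \<Longrightarrow> dist z z' < d \<Longrightarrow> p \<in> P z \<Longrightarrow>
       \<exists>q\<in>P z'. \<forall>s\<ge>0. \<bar>k (p s) - k (q s)\<bar> \<le> e"
    using shadow[OF \<open>e > 0\<close>] by metis
  obtain M where "M \<ge> 0" and M: "\<And>z p t. z \<in> G \<Longrightarrow> p \<in> P z \<Longrightarrow> t \<ge> 0 \<Longrightarrow> \<exists>q\<in>P z. \<exists>m\<in>{0..M}. dist (p t) (q m) < d"
    using bounded_time_reach[OF \<open>d > 0\<close>] by metis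
  show ?thesis
  proof (rule that[OF \<open>M \<ge> 0\<close>])
    fix z p m assume z: "z \<in> G" and p: "p \<in> P z" and m: "m \<ge> (0::real)"
    obtain q m' where q: "q \<in> P z" and m': "m' \<in> {0..M}" and near: "dist (p m) (q m') < d"
      using M[OF z p m] by blast
    have qm: "q m' \<in> G" using play_in[OF z q] m' by simp
    have pm: "p m \<in> G" "tail p m \<in> P (p m)" using play_tail[OF z p m] by auto
    obtain r where r: "r \<in> P (q m')" "\<And>s. s \<ge> 0 \<Longrightarrow> \<bar>k (tail p m s) - k (r s)\<bar> \<le> e"
      using d[OF pm(1) qm near pm(2)] by blast
    have m'0: "0 \<le> m'" using m' by simp
    obtain c where c: "c \<in> P z" "\<And>t. 0 \<le> t \<Longrightarrow> cost c (m' + t) = cost q m' + cost r t"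
      using concat_two_cost[OF z q m'0 r(1)] by blast
    have "cost c (m' + t) \<le> cost (tail p m) t + t * e + M * B" if t: "t \<ge> 0" for t
    proof -
      have "cost r t \<le> cost (tail p m) t + t * e"
      proof (rule cost_near[OF qm r(1) pm t])
        show "k (r s) \<le> k (p (m + s)) + e" if "0 \<le> s" for s
          using r(2)[OF that] by (simp add: abs_le_iff)
      qed
      moreover have "cost q m' \<le> m' * B" using cost_bound[OF z q, of m'] m' by simp
      moreover have "m' * B \<le> M * B" using m' B_nonneg by (intro mult_right_mono) auto
      ultimately show ?thesis using c(2)[OF t] by linarith
    qed
    then show "\<exists>r\<in>P z. \<exists>m'\<in>{0..M}. \<forall>t\<ge>0. cost r (m' + t) \<le> cost (tail p m) t + t * e + M * B"
      using c(1) m' by blast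
  qed
qed

text \<open>The delay \<open>m\<close> is replaced by one of at most \<open>M\<close>, and then dropped: over a long horizon \<open>t\<close> the costs on
\<open>[0, t]\<close> and \<open>[m', m' + t]\<close> have nearly the same average. Neither step depends on \<open>z\<close>.\<close>

lemma V0_le_V:
  assumes "e > 0"
  obtains T where "T > 0" "\<And>t z m. t \<ge> T \<Longrightarrow> z \<in> G \<Longrightarrow> m \<ge> 0 \<Longrightarrow> V 0 t z \<le> V m t z + e"
proof -
  obtain M where "M \<ge> 0" and M: "\<And>z p m. z \<in> G \<Longrightarrow> p \<in> P z \<Longrightarrow> m \<ge> 0 \<Longrightarrow>
      \<exists>r\<in>P z. \<exists>m'\<in>{0..M}. \<forall>t\<ge>0. cost r (m' + t) \<le> cost (tail p m) t + t * (e / 4) + M * B"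
    using bounded_delay[of "e / 4"] \<open>e > 0\<close> by (metis divide_pos_pos zero_less_numeral)
  \<comment> \<open>Beyond \<open>T\<close>, an approach phase of length \<open>M\<close> changes an average by at most \<open>e/2\<close>.\<close>
  define T where "T = 4 * M * B / e + 1"
  have "T > 0" using \<open>M \<ge> 0\<close> \<open>e > 0\<close> B_nonneg by (simp add: T_def add_nonneg_pos)
  show ?thesis
  proof (rule that[OF \<open>T > 0\<close>])
    fix t z m assume as: "t \<ge> T" "z \<in> G" "m \<ge> (0::real)"
    then have t: "t > 0" using \<open>T > 0\<close> by linarith
    obtain p where p: "p \<in> P z" "cost (tail p m) t \<le> t * (V m t z + e / 4)"
      using V_attain[OF as(2) t, of "e/4" m] \<open>e > 0\<close> by auto
    obtain r m' where r: "r \<in> P z" and m': "m' \<in> {0..M}"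
      and cost_r: "\<And>t. t \<ge> 0 \<Longrightarrow> cost r (m' + t) \<le> cost (tail p m) t + t * (e / 4) + M * B"
      using M[OF as(2) p(1) as(3)] by blast
    have "cost r (t + m') = cost r t + cost (tail r t) m'" by (rule cost_shift[OF as(2) r]) (use t m' in auto)
    moreover have "\<bar>cost (tail r t) m'\<bar> \<le> m' * B"
      using cost_bound[of "r t" "tail r t" m'] play_tail[OF as(2) r, of t] t m' by simp
    moreover have "m' * B \<le> M * B" using m' B_nonneg by (intro mult_right_mono) auto
    ultimately have "cost r t \<le> cost (tail p m) t + t * (e / 4) + 2 * (M * B)"
      using cost_r[of t] t by (simp add: add.commute abs_le_iff)
    moreover have "2 * (M * B) \<le> t * (e / 2)"
      using as(1) \<open>e > 0\<close> by (simp add: T_def field_simps)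
    ultimately have "t * V 0 t z \<le> t * (V m t z + e)"
      using V_le[OF as(2) r order_refl t] p(2) by (simp add: algebra_simps)
    then show "V 0 t z \<le> V m t z + e" using t by simp
  qed
qed

text \<open>A value computed from a state of a play can be realised from its origin, with a larger delay.\<close>

lemma V_after: 
  assumes z: "z \<in> G" and p: "p \<in> P z" and s: "0 \<le> s" and m: "0 \<le> m" and t: "0 < t"
  shows "V (s + m) t z \<le> V m t (p s)"
proof (rule V_ge[OF play_in[OF z p s] t])
  fix q assume q: "q \<in> P (p s)"
  obtain r where r: "r \<in> P z" "\<And>m t. 0 \<le> m \<Longrightarrow> cost (tail r (s + m)) t = cost (tail q m) t"
    using concat_two_cost[OF z p s q] by blast
  have "t * V (s + m) t z \<le> cost (tail r (s + m)) t" by (rule V_le[OF z r(1)]) (use m s t in auto)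
  then show "t * V (s + m) t z \<le> cost (tail q m) t" using r(2)[OF m, of t] by linarith
qed

text \<open>Cut \<open>[0, T]\<close> into blocks of length \<open>s\<close>. The cost of the block that starts at \<open>m\<close> is at least
\<open>s V\<^sub>m\<^sub>,\<^sub>s \<ge> s inf\<^sub>m V\<^sub>m\<^sub>,\<^sub>s\<close>, and the incomplete last block contributes \<open>O(s)\<close>.\<close>

lemma Vinf_le_V0:
  assumes z: "z \<in> G" and s: "0 < s" and T: "0 < T"
  shows "Vinf s z \<le> V 0 T z + 2 * B * s / T"
proof -
  have "Vinf s z - 2 * B * s / T \<le> V 0 T z"
  proof (rule V_ge[OF z T])
    fix p assume p: "p \<in> P z"
    \<comment> \<open>Complete blocks, before the remainder of length less than \<open>s\<close> is dealt with.\<close>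
    have blocks: "real n * s * Vinf s z \<le> cost p (real n * s)" for n
    proof (induction n)
      case 0 show ?case by (simp add: cost_def)
    next
      case (Suc n)
      have ns: "0 \<le> real n * s" using s by simp
      have "cost p (real (Suc n) * s) = cost p (real n * s) + cost (tail p (real n * s)) s"
        using cost_shift[OF z p ns, of s] s by (simp add: algebra_simps)
      moreover have "s * Vinf s z \<le> s * V (real n * s) s z"
        using Vinf_le[OF z s ns] s by simp
      ultimately show ?case using Suc.IH V_le[OF z p ns s] by (simp add: algebra_simps)
    qed
    define n where "n = nat \<lfloor>T / s\<rfloor>"
    have "real n = of_int \<lfloor>T / s\<rfloor>" using T s by (simp add: n_def)
    then have "real n \<le> T / s" "T / s < real n + 1" by linarith+
    then have n: "real n * s \<le> T" "T - real n * s \<le> s" using s by (auto simp: field_simps)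
    have ns: "0 \<le> real n * s" using s by simp
    have "cost p T = cost p (real n * s) + cost (tail p (real n * s)) (T - real n * s)"
      using cost_shift[OF z p ns, of "T - real n * s"] n by simp
    moreover have "\<bar>cost (tail p (real n * s)) (T - real n * s)\<bar> \<le> (T - real n * s) * B"
      using cost_bound[of "p (real n * s)" "tail p (real n * s)" "T - real n * s"] play_tail[OF z p ns] n by simp
    moreover have "(T - real n * s) * B \<le> s * B" using n B_nonneg by (intro mult_right_mono) auto
    moreover have "(T - real n * s) * Vinf s z \<le> s * B"
    proof -
      have "(T - real n * s) * Vinf s z \<le> (T - real n * s) * B"
        using Vinf_bound[OF z s] n by (intro mult_left_mono) auto
      then show ?thesis using \<open>(T - real n * s) * B \<le> s * B\<close> by linarith
    qed
    ultimately have "T * Vinf s z - 2 * B * s \<le> cost p T"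
      using blocks[of n] by (simp add: algebra_simps abs_le_iff)
    then show "T * (Vinf s z - 2 * B * s / T) \<le> cost (tail p 0) T"
      using T by (simp add: algebra_simps)
  qed
  then show ?thesis by simp
qed

lemma V0_le_Vstar:
  assumes "e > 0"
  obtains T where "T > 0" "\<And>t z. t \<ge> T \<Longrightarrow> z \<in> G \<Longrightarrow> V 0 t z - e \<le> Vinf t z"
    "\<And>t z. t \<ge> T \<Longrightarrow> z \<in> G \<Longrightarrow> V 0 t z \<le> Vstar z + e"
proof -
  obtain T where "T > 0" and T: "\<And>t z m. t \<ge> T \<Longrightarrow> z \<in> G \<Longrightarrow> m \<ge> 0 \<Longrightarrow> V 0 t z \<le> V m t z + e"
    using V0_le_V[OF \<open>e > 0\<close>] by metis
  have 1: "V 0 t z - e \<le> Vinf t z" if "t \<ge> T" "z \<in> G" for t z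
    by (rule Vinf_ge) (use T[OF that] in \<open>simp add: algebra_simps\<close>)
  have "V 0 t z \<le> Vstar z + e" if "t \<ge> T" "z \<in> G" for t z
    using 1[OF that] Vstar_ge[of z t] that \<open>T > 0\<close> by simp
  with 1 show ?thesis using that[OF \<open>T > 0\<close>] by blast
qed

text \<open>Here the horizon depends on \<open>z\<close>, through the horizon \<open>s\<close> at which \<open>inf\<^sub>m V\<^sub>m\<^sub>,\<^sub>s\<close> comes close to its
supremum \<open>V\<^sup>*\<close>.\<close>

lemma eventually_Vstar_le_V0:
  assumes z: "z \<in> G" and "e > 0"
  shows "eventually (\<lambda>t. Vstar z - e \<le> V 0 t z) at_top"
proof -
  have "\<exists>s>0. Vstar z - e / 2 < Vinf s z"
    using Vstar_le[of z "Vstar z - e / 2"] \<open>e > 0\<close> by fastforce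
  then obtain s where s: "s > 0" "Vstar z - e / 2 < Vinf s z" by blast
  have "eventually (\<lambda>t. t \<ge> 4 * B * s / e \<and> t > 0) at_top"
    using eventually_ge_at_top[of "4 * B * s / e"] eventually_gt_at_top[of 0] by eventually_elim auto
  then show ?thesis
  proof eventually_elim
    case (elim t)
    then have "2 * B * s / t \<le> e / 2" using \<open>e > 0\<close> by (simp add: field_simps)
    then show ?case using Vinf_le_V0[OF z s(1), of t] elim s(2) by linarith
  qed
qed

text \<open>The lower bound becomes uniform by imposing it on the points of a finite net and using equicontinuity.\<close>

lemma V0_uniform_convergence:
  assumes "e > 0"
  obtains T where "T > 0" "\<And>t z. t \<ge> T \<Longrightarrow> z \<in> G \<Longrightarrow> \<bar>V 0 t z - Vstar z\<bar> \<le> e"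
proof -
  define e' where "e' = e / 3"
  have "e' > 0" using \<open>e > 0\<close> by (simp add: e'_def)
  obtain T where "T > 0" and T: "\<And>t z. t \<ge> T \<Longrightarrow> z \<in> G \<Longrightarrow> V 0 t z \<le> Vstar z + e'"
    using V0_le_Vstar[OF \<open>e' > 0\<close>] by metis
  obtain d where "d > 0" and d: "\<And>z z' m t. z \<in> G \<Longrightarrow> z' \<in> G \<Longrightarrow> dist z z' < d \<Longrightarrow> 0 \<le> m \<Longrightarrow> 0 < t \<Longrightarrow>
     V m t z \<le> V m t z' + e'"
    using V_equicontinuous[OF \<open>e' > 0\<close>] by metis
  obtain F where F: "finite F" "F \<subseteq> G" "G \<subseteq> (\<Union>f\<in>F. ball f d)"
    using finite_net[OF \<open>d > 0\<close>] by blast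
  have "eventually (\<lambda>t. \<forall>f\<in>F. Vstar f - e' \<le> V 0 t f) at_top"
    using F(1,2) \<open>e' > 0\<close> by (intro eventually_ball_finite ballI eventually_Vstar_le_V0) auto
  then obtain T' where T': "\<And>t f. t \<ge> T' \<Longrightarrow> f \<in> F \<Longrightarrow> Vstar f - e' \<le> V 0 t f"
    unfolding eventually_at_top_linorder by blast
  show ?thesis
  proof (rule that[of "max T T'"])
    fix t z assume t: "t \<ge> max T T'" and z: "z \<in> G"
    then have "t > 0" using \<open>T > 0\<close> by simp
    obtain f where f: "f \<in> F" "dist f z < d" using F(3) z by auto
    then have fG: "f \<in> G" using F(2) by blast
    have "Vstar z \<le> Vstar f + e'"
      by (rule Vstar_equicontinuous[OF d[OF z fG] z fG]) (use f(2) in \<open>auto simp: dist_commute\<close>)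
    moreover have "V 0 t f \<le> V 0 t z + e'" using d[OF fG z f(2)] \<open>t > 0\<close> by simp
    ultimately show "\<bar>V 0 t z - Vstar z\<bar> \<le> e"
      using T[OF _ z, of t] T'[OF _ f(1), of t] t \<open>e' > 0\<close> by (simp add: e'_def abs_le_iff)
  qed (use \<open>T > 0\<close> in simp)
qed

end

section \<open>Uniform value and joint limit\<close>

context nonexpansive_plays
begin

text \<open>As long as expensive blocks, of average more than \<open>c\<close> and length between 1 and \<open>n\<close>, are available from
every date up to \<open>H\<close>, they can be chained; each one moves the date by at least 1, so \<open>H\<close> is passed.\<close>

lemma greedy_blocks:
  assumes z: "z \<in> G" and p: "p \<in> P z"
    and bad: "\<And>m. 0 \<le> m \<Longrightarrow> m \<le> H \<Longrightarrow> \<exists>t. 1 \<le> t \<and> t \<le> n \<and> t * c < cost (tail p m) t"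
  shows "\<exists>m\<ge>0. m \<le> max 0 (H + n) \<and> min (real N) H \<le> m \<and> m * c \<le> cost p m"
proof (induction N)
  case 0
  show ?case by (intro exI[of _ 0]) (simp add: cost_def)
next
  case (Suc N)
  then obtain m where m: "0 \<le> m" "m \<le> max 0 (H + n)" "min (real N) H \<le> m" "m * c \<le> cost p m" by blast
  show ?case
  proof (cases "m \<le> H")
    case True
    then obtain t where t: "1 \<le> t" "t \<le> n" "t * c < cost (tail p m) t" using bad[OF m(1)] by blast
    have "cost p (m + t) = cost p m + cost (tail p m) t" by (rule cost_shift[OF z p m(1)]) (use t in simp)
    then have "(m + t) * c \<le> cost p (m + t)" using m(4) t(3) by (simp add: distrib_right)
    then show ?thesis using m t True by (intro exI[of _ "m + t"]) auto
  next
    case False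
    then show ?thesis using m by (intro exI[of _ m]) auto
  qed
qed

text \<open>If the averages over \<open>[m, m + t]\<close>, \<open>1 \<le> t \<le> n\<close>, never were all cheap, expensive blocks would fill
\<open>[0, T]\<close> up to a length \<open>n\<close>, contradicting the almost optimality of \<open>p\<close> for a large horizon \<open>T\<close>.\<close>

lemma eventually_cheap_stretch:
  assumes z: "z \<in> G" and "e > 0" and "1 \<le> n"
  shows "\<exists>p\<in>P z. \<exists>m\<ge>0. \<forall>t. 1 \<le> t \<longrightarrow> t \<le> n \<longrightarrow> cost (tail p m) t \<le> t * (Vstar z + e)"
proof -
  define c where "c = Vstar z + e"
  obtain T0 where "T0 > 0" and T0: "\<And>t z. t \<ge> T0 \<Longrightarrow> z \<in> G \<Longrightarrow> V 0 t z \<le> Vstar z + e / 4"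
    using V0_le_Vstar[of "e / 4"] \<open>e > 0\<close> by (metis divide_pos_pos zero_less_numeral)
  \<comment> \<open>The last term makes the gain \<open>T e/2\<close> exceed what the uncovered length \<open>n\<close> can contribute.\<close>
  define T where "T = max (max T0 n) (2 * n * (\<bar>c\<bar> + B) / e + 1)"
  have T: "T \<ge> T0" "T \<ge> n" "2 * n * (\<bar>c\<bar> + B) / e < T" by (auto simp: T_def)
  have "T > 0" using T(1) \<open>T0 > 0\<close> by linarith
  obtain p where p: "p \<in> P z" and "cost (tail p 0) T \<le> T * (V 0 T z + e / 4)"
    using V_attain[OF z \<open>T > 0\<close>, of "e/4" 0] \<open>e > 0\<close> by auto
  moreover have "T * (V 0 T z + e / 4) \<le> T * (Vstar z + e / 2)"
    using T0[OF T(1) z] \<open>T > 0\<close> by (intro mult_left_mono) auto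
  ultimately have "cost p T \<le> T * (Vstar z + e / 2)" by simp
  moreover have ce: "c - e / 2 = Vstar z + e / 2" by (simp add: c_def)
  ultimately have cost_T: "cost p T \<le> T * (c - e / 2)" by (simp only: ce)
  have "\<exists>m\<ge>0. \<forall>t. 1 \<le> t \<longrightarrow> t \<le> n \<longrightarrow> cost (tail p m) t \<le> t * c"
  proof (rule ccontr)
    assume neg: "\<not> (\<exists>m\<ge>0. \<forall>t. 1 \<le> t \<longrightarrow> t \<le> n \<longrightarrow> cost (tail p m) t \<le> t * c)"
    have bad: "\<exists>t. 1 \<le> t \<and> t \<le> n \<and> t * c < cost (tail p m) t" if "0 \<le> m" for m
      using neg that by (meson not_le)
    obtain N where N: "T - n \<le> real N" using real_arch_simple by blast
    obtain m where m: "0 \<le> m" "m \<le> max 0 (T - n + n)" "min (real N) (T - n) \<le> m" "m * c \<le> cost p m"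
      using greedy_blocks[OF z p bad, of "T - n" N] by blast
    have mT: "m \<le> T" "T - m \<le> n" using m N T(2) \<open>T > 0\<close> by auto
    have "cost p T = cost p m + cost (tail p m) (T - m)" using cost_shift[OF z p m(1), of "T - m"] mT by simp
    moreover have "- (n * B) \<le> cost (tail p m) (T - m)"
    proof -
      have "\<bar>cost (tail p m) (T - m)\<bar> \<le> (T - m) * B"
        using cost_bound[of "p m" "tail p m"] play_tail[OF z p m(1)] mT by simp
      moreover have "(T - m) * B \<le> n * B" using mT B_nonneg by (intro mult_right_mono) auto
      ultimately show ?thesis by linarith
    qed
    moreover have "(T - m) * c \<le> n * \<bar>c\<bar>"
    proof -
      have "(T - m) * c \<le> (T - m) * \<bar>c\<bar>" using mT by (intro mult_left_mono) auto
      also have "\<dots> \<le> n * \<bar>c\<bar>" using mT by (intro mult_right_mono) auto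
      finally show ?thesis .
    qed
    ultimately have "T * c - n * \<bar>c\<bar> - n * B \<le> T * (c - e / 2)"
      using m(4) cost_T by (simp add: left_diff_distrib)
    then have "T * e \<le> 2 * n * (\<bar>c\<bar> + B)" by (simp add: algebra_simps)
    then show False using T(3) \<open>e > 0\<close> by (simp add: divide_less_eq)
  qed
  then show ?thesis using p by (auto simp: c_def)
qed

text \<open>The cheap stretch of the previous lemma may start late, at a date that depends on \<open>n\<close>. Bounded delay
moves it to a date at most \<open>M\<close>, which is absorbed for \<open>t \<ge> t0\<close>. It is essential for concatenation that
\<open>t0\<close> depends neither on \<open>n\<close> nor on \<open>z\<close>.\<close>

lemma finite_horizon_cheap:
  assumes "e > 0"
  obtains t0 where "t0 > 0"
    "\<And>n z. z \<in> G \<Longrightarrow> \<exists>p\<in>P z. \<forall>t. t0 \<le> t \<longrightarrow> t \<le> n \<longrightarrow> cost p t \<le> t * (Vstar z + e)"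
proof -
  obtain M where "M \<ge> 0" and M: "\<And>z p m. z \<in> G \<Longrightarrow> p \<in> P z \<Longrightarrow> m \<ge> 0 \<Longrightarrow>
      \<exists>r\<in>P z. \<exists>m'\<in>{0..M}. \<forall>t\<ge>0. cost r (m' + t) \<le> cost (tail p m) t + t * (e / 4) + M * B"
    using bounded_delay[of "e / 4"] \<open>e > 0\<close> by (metis divide_pos_pos zero_less_numeral)
  \<comment> \<open>One unit of time beyond \<open>M\<close>, since the stretch is cheap only from length 1 on, and enough to average out its cost.\<close>
  define t0 where "t0 = M + 1 + 4 * (M * B) / e"
  have "t0 > 0" using \<open>M \<ge> 0\<close> \<open>e > 0\<close> B_nonneg by (simp add: t0_def add_pos_nonneg)
  have t0M: "M + 1 \<le> t0" using \<open>M \<ge> 0\<close> \<open>e > 0\<close> B_nonneg by (simp add: t0_def)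
  show ?thesis
  proof (rule that[OF \<open>t0 > 0\<close>])
    fix n z assume z: "z \<in> G"
    define c where "c = Vstar z + e / 2"
    obtain p m where p: "p \<in> P z" "0 \<le> m"
      and pm: "\<And>t. 1 \<le> t \<Longrightarrow> t \<le> max n 1 \<Longrightarrow> cost (tail p m) t \<le> t * (Vstar z + e / 4)"
      using eventually_cheap_stretch[OF z, of "e/4" "max n 1"] \<open>e > 0\<close> by auto
    obtain r m' where r: "r \<in> P z" and m': "m' \<in> {0..M}"
      and cost_r: "\<And>t. t \<ge> 0 \<Longrightarrow> cost r (m' + t) \<le> cost (tail p m) t + t * (e / 4) + M * B"
      using M[OF z p] by blast
    have "cost r t \<le> t * (Vstar z + e)" if t: "t0 \<le> t" "t \<le> n" for t
    proof -
      have tm: "1 \<le> t - m'" "t - m' \<le> max n 1" using t t0M m' by auto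
      have "cost r t \<le> cost (tail p m) (t - m') + (t - m') * (e / 4) + M * B"
        using cost_r[of "t - m'"] tm by simp
      also have "cost (tail p m) (t - m') \<le> (t - m') * (Vstar z + e / 4)" by (rule pm[OF tm])
      finally have "cost r t \<le> t * c - m' * c + M * B" by (simp add: c_def algebra_simps)
      moreover have "- (m' * c) \<le> M * B"
      proof -
        have "m' * - c \<le> m' * B"
          using Vstar_bound[OF z] m' \<open>e > 0\<close> by (intro mult_left_mono) (auto simp: c_def)
        also have "\<dots> \<le> M * B" using m' B_nonneg by (intro mult_right_mono) auto
        finally show ?thesis by simp
      qed
      moreover have "2 * (M * B) \<le> t * (e / 2)"
      proof -
        have "4 * (M * B) / e \<le> t" using t(1) \<open>M \<ge> 0\<close> by (simp add: t0_def)
        then show ?thesis using \<open>e > 0\<close> by (simp add: field_simps)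
      qed
      ultimately have "cost r t \<le> t * c + t * (e / 2)" by linarith
      then show ?thesis by (simp add: c_def algebra_simps)
    qed
    then show "\<exists>p\<in>P z. \<forall>t. t0 \<le> t \<longrightarrow> t \<le> n \<longrightarrow> cost p t \<le> t * (Vstar z + e)" using r by blast
  qed
qed

text \<open>Be cheap until \<open>2 n\<close> rather than \<open>n\<close>. If \<open>V\<^sup>*\<close> were much larger at date \<open>n\<close> than initially, the second
half would cost about \<open>n V\<^sup>*(p n)\<close>, while the first half costs at least about \<open>n V\<^sup>*(z)\<close>, so the total could
not be close to \<open>2 n V\<^sup>*(z)\<close>.\<close>

lemma cheap_block:
  assumes "e > 0"
  shows "\<exists>t0>0. \<exists>N\<ge>t0. \<forall>n\<ge>N. \<forall>z\<in>G. \<exists>p\<in>P z.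
    (\<forall>t. t0 \<le> t \<longrightarrow> t \<le> n \<longrightarrow> cost p t \<le> t * (Vstar z + e)) \<and> Vstar (p n) \<le> Vstar z + 4 * e"
proof -
  obtain t0 where "t0 > 0" and t0: "\<And>n z. z \<in> G \<Longrightarrow> \<exists>p\<in>P z. \<forall>t. t0 \<le> t \<longrightarrow> t \<le> n \<longrightarrow> cost p t \<le> t * (Vstar z + e)"
    using finite_horizon_cheap[OF \<open>e > 0\<close>] by metis
  obtain T where "T > 0" and T: "\<And>t z. t \<ge> T \<Longrightarrow> z \<in> G \<Longrightarrow> \<bar>V 0 t z - Vstar z\<bar> \<le> e"
    using V0_uniform_convergence[OF \<open>e > 0\<close>] by metis
  show ?thesis
  proof (rule exI[of _ t0], rule conjI[OF \<open>t0 > 0\<close>], rule exI[of _ "max t0 T"], intro conjI allI ballI impI)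
    fix n z assume n: "n \<ge> max t0 T" and z: "z \<in> G"
    then have "n > 0" using \<open>t0 > 0\<close> by linarith
    obtain p where p: "p \<in> P z" and cost_p: "\<And>t. t0 \<le> t \<Longrightarrow> t \<le> 2 * n \<Longrightarrow> cost p t \<le> t * (Vstar z + e)"
      using t0[OF z, of "2 * n"] by blast
    have pn: "p n \<in> G" "tail p n \<in> P (p n)" using play_tail[OF z p] \<open>n > 0\<close> by auto
    have "cost p (2 * n) = cost p n + cost (tail p n) n" using cost_shift[OF z p, of n n] \<open>n > 0\<close> by simp
    moreover have "cost p (2 * n) \<le> (2 * n) * (Vstar z + e)" using n \<open>n > 0\<close> by (intro cost_p) auto
    moreover have "n * (Vstar z - e) \<le> cost p n"
    proof -
      have "n * (Vstar z - e) \<le> n * V 0 n z" using T[OF _ z, of n] n \<open>n > 0\<close> by (intro mult_left_mono) auto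
      then show ?thesis using V_le[OF z p order_refl \<open>n > 0\<close>] by simp
    qed
    moreover have "n * (Vstar (p n) - e) \<le> cost (tail p n) n"
    proof -
      have "n * (Vstar (p n) - e) \<le> n * V 0 n (p n)" using T[OF _ pn(1), of n] n \<open>n > 0\<close> by (intro mult_left_mono) auto
      then show ?thesis using V_le[OF pn order_refl \<open>n > 0\<close>] by simp
    qed
    ultimately have "n * (Vstar (p n) - e) + n * (Vstar z - e) \<le> (2 * n) * (Vstar z + e)" by linarith
    then have "n * Vstar (p n) \<le> n * (Vstar z + 4 * e)" by (simp add: algebra_simps)
    then have "Vstar (p n) \<le> Vstar z + 4 * e" using \<open>n > 0\<close> by simp
    then show "\<exists>p\<in>P z. (\<forall>t. t0 \<le> t \<longrightarrow> t \<le> n \<longrightarrow> cost p t \<le> t * (Vstar z + e)) \<and> Vstar (p n) \<le> Vstar z + 4 * e"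
      using cost_p \<open>n > 0\<close> by (intro bexI[OF _ p]) auto
  qed simp
qed

text \<open>Concatenate cheap blocks with errors \<open>e j = e0/2\<^sup>j\<close>. The losses \<open>4 e j\<close> of \<open>V\<^sup>*\<close> at the nodes add up to at
most \<open>8 e0\<close>, so every complete block has average at most \<open>C = V\<^sup>*(z) + 9 e0\<close>. Inside the block \<open>j + 1\<close> this
is known only after a delay \<open>t0 (j + 1)\<close>, which is harmless because the length of the block \<open>j\<close>, and hence
the elapsed time, is chosen at least \<open>t0 (j + 1)/e0\<close>.\<close>

theorem uniform_value:
  assumes z: "z \<in> G" and "\<epsilon> > 0"
  shows "\<exists>r\<in>P z. \<exists>T>0. \<forall>t\<ge>T. cost r t \<le> t * (Vstar z + \<epsilon>)"
proof -
  \<comment> \<open>The final error is \<open>9 e0\<close> from the values at the nodes and \<open>2 B e0\<close> from the current block.\<close>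
  define e0 where "e0 = \<epsilon> / (9 + 2 * B)"
  have "e0 > 0" using \<open>\<epsilon> > 0\<close> B_nonneg by (simp add: e0_def)
  have "(9 + 2 * B) * e0 = \<epsilon>" using B_nonneg by (simp add: e0_def)
  then have e0: "9 * e0 + 2 * B * e0 = \<epsilon>" by (simp add: distrib_right)
  define e where "e j = e0 * (1/2) ^ j" for j :: nat
  have epos: "e j > 0" and ele: "e j \<le> e0" for j
    using \<open>e0 > 0\<close> by (auto simp: e_def power_le_one mult_le_cancel_left2)
  define C where "C = Vstar z + 9 * e0"
  define Q where "Q j t0 N \<longleftrightarrow> 0 < t0 \<and> t0 \<le> N \<and> (\<forall>n\<ge>N. \<forall>x\<in>G. \<exists>p\<in>P x.
      (\<forall>t. t0 \<le> t \<longrightarrow> t \<le> n \<longrightarrow> cost p t \<le> t * (Vstar x + e j)) \<and> Vstar (p n) \<le> Vstar x + 4 * e j)" for j t0 N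
  have "\<exists>t0 N. Q j t0 N" for j
    unfolding Q_def using cheap_block[OF epos[of j]] by blast
  then obtain t0 N where Q: "\<And>j. Q j (t0 j) (N j)" by metis
  define l where "l j = max (max 1 (N j)) (t0 (Suc j) / e0)" for j
  have t0pos: "t0 j > 0" and l1: "l j \<ge> 1" and lN: "l j \<ge> N j" and lt: "l j \<ge> t0 j"
    and ln: "t0 (Suc j) \<le> e0 * l j" for j
  proof -
    show "t0 j > 0" "l j \<ge> 1" "l j \<ge> N j" "l j \<ge> t0 j" using Q[of j] by (auto simp: Q_def l_def)
    have "t0 (Suc j) / e0 \<le> l j" by (simp add: l_def)
    then show "t0 (Suc j) \<le> e0 * l j" using \<open>e0 > 0\<close> by (simp add: field_simps)
  qed
  have lpos: "l j > 0" for j using l1[of j] by linarith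
  have block: "\<exists>p\<in>P x. (\<forall>t. t0 j \<le> t \<longrightarrow> t \<le> l j \<longrightarrow> cost p t \<le> t * (Vstar x + e j)) \<and> Vstar (p (l j)) \<le> Vstar x + 4 * e j"
    if "x \<in> G" for j x
    using Q[of j, unfolded Q_def] lN[of j] that by blast
  \<comment> \<open>A block: its initial state and its play.\<close>
  define ok where "ok j w \<longleftrightarrow> fst w \<in> G \<and> snd w \<in> P (fst w) \<and>
      (\<forall>t. t0 j \<le> t \<longrightarrow> t \<le> l j \<longrightarrow> cost (snd w) t \<le> t * (Vstar (fst w) + e j)) \<and>
      Vstar (snd w (l j)) \<le> Vstar (fst w) + 4 * e j" for j and w :: "'a \<times> (real \<Rightarrow> 'a)"
  have ok_ex: "\<exists>w. ok j w \<and> fst w = x" if x: "x \<in> G" for j x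
  proof -
    obtain p where "p \<in> P x" "\<forall>t. t0 j \<le> t \<longrightarrow> t \<le> l j \<longrightarrow> cost p t \<le> t * (Vstar x + e j)" "Vstar (p (l j)) \<le> Vstar x + 4 * e j"
      using block[OF x, of j] by blast
    then show ?thesis using x by (intro exI[of _ "(x, p)"]) (simp add: ok_def)
  qed
  have "\<exists>f. \<forall>j. ((j = 0 \<longrightarrow> fst (f j) = z) \<and> ok j (f j)) \<and> fst (f (Suc j)) = snd (f j) (l j)"
  proof (rule dependent_nat_choice)
    show "\<exists>w. ((0::nat) = 0 \<longrightarrow> fst w = z) \<and> ok 0 w" using ok_ex[OF z, of 0] by blast
  next
    fix w j assume "(j = 0 \<longrightarrow> fst w = z) \<and> ok j w"
    then have "snd w (l j) \<in> G" using play_in[of "fst w" "snd w" "l j"] lpos[of j] by (simp add: ok_def)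
    from ok_ex[OF this, of "Suc j"]
    show "\<exists>w'. ((Suc j = 0 \<longrightarrow> fst w' = z) \<and> ok (Suc j) w') \<and> fst w' = snd w (l j)" by blast
  qed
  then obtain f where f: "\<And>j. (j = 0 \<longrightarrow> fst (f j) = z) \<and> ok j (f j)" "\<And>j. fst (f (Suc j)) = snd (f j) (l j)"
    by blast
  define x p where "x j = fst (f j)" and "p j = snd (f j)" for j
  have x0: "x 0 = z" and xS: "p j (l j) = x (Suc j)" for j using f by (auto simp: x_def p_def)
  have xG: "x j \<in> G" and pP: "p j \<in> P (x j)"
    and cost_p: "\<And>t. t0 j \<le> t \<Longrightarrow> t \<le> l j \<Longrightarrow> cost (p j) t \<le> t * (Vstar (x j) + e j)"
    and Vx: "Vstar (x (Suc j)) \<le> Vstar (x j) + 4 * e j" for j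
    using f(1)[of j] f(2)[of j] by (auto simp: ok_def x_def p_def)
  define S where "S n = (\<Sum>i<n. l i)" for n
  have S_Suc: "S (Suc n) = S n + l n" for n by (simp add: S_def)
  have S_ge: "real n \<le> S n" for n
  proof (induction n)
    case (Suc n) then show ?case using l1[of n] by (simp add: S_Suc)
  qed (simp add: S_def)
  have S0: "0 \<le> S n" for n using S_ge[of n] of_nat_0_le_iff order_trans by blast
  have unb: "\<exists>n. c < (\<Sum>i<n. l i)" for c
  proof -
    obtain n where "c < real n" using reals_Archimedean2 by blast
    then show ?thesis using S_ge[of n] by (intro exI[of _ n]) (simp add: S_def)
  qed
  obtain r where rP: "r \<in> P z" and r: "\<And>n t. 0 \<le> t \<Longrightarrow> t \<le> l n \<Longrightarrow> r (S n + t) = p n t"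
    using play_concat[of l x p, OF lpos unb xG pP xS] unfolding S_def x0 by auto
  have cost_split: "cost r (S n + t) = cost r (S n) + cost (p n) t" if "0 \<le> t" "t \<le> l n" for n t
  proof -
    have "cost (tail r (S n)) t = cost (p n) t" by (rule cost_cong) (use r that in auto)
    then show ?thesis using cost_shift[OF z rP S0 that(1), of n] by simp
  qed
  have geo: "(\<Sum>i<n. e i) \<le> 2 * e0" for n
  proof -
    have "(\<Sum>i<n. e i) = e0 * (2 - 2 * (1/2) ^ n)"
      by (induction n) (simp_all add: e_def algebra_simps)
    also have "\<dots> \<le> e0 * 2" using \<open>e0 > 0\<close> by (intro mult_left_mono) auto
    finally show ?thesis by simp
  qed
  have "Vstar (x n) \<le> Vstar z + 4 * (\<Sum>i<n. e i)" for n
  proof (induction n)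
    case (Suc n) then show ?case using Vx[of n] by simp
  qed (simp add: x0)
  note Vxn = this
  have VC: "Vstar (x n) + e n \<le> C" for n
    using Vxn[of n] geo[of n] ele[of n] unfolding C_def by linarith
  have cost_pC: "cost (p n) t \<le> t * C" if "t0 n \<le> t" "t \<le> l n" for n t
  proof -
    have "cost (p n) t \<le> t * (Vstar (x n) + e n)" by (rule cost_p[OF that])
    also have "\<dots> \<le> t * C" using VC[of n] that t0pos[of n] by (intro mult_left_mono) auto
    finally show ?thesis .
  qed
  have cost_S: "cost r (S n) \<le> S n * C" for n
  proof (induction n)
    case 0 show ?case by (simp add: S_def cost_def)
  next
    case (Suc n)
    have "cost r (S (Suc n)) = cost r (S n) + cost (p n) (l n)"
      using cost_split[of "l n" n] lpos[of n] by (simp add: S_Suc)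
    then show ?case using Suc.IH cost_pC[OF lt order_refl, of n] by (simp add: S_Suc algebra_simps)
  qed
  have BC: "B - C \<le> 2 * B" using Vstar_bound[OF z] \<open>e0 > 0\<close> by (simp add: C_def abs_le_iff)
  have "cost r t \<le> t * (Vstar z + \<epsilon>)" if t: "t \<ge> S 1" for t
  proof -
    have tpos: "0 \<le> t" using S0[of 1] t by linarith
    define n where "n = (LEAST n. t < S (Suc n))"
    have "\<exists>n. t < S (Suc n)"
    proof -
      obtain n where "t < S n" using unb[of t] by (auto simp: S_def)
      then show ?thesis using S_Suc[of n] lpos[of n] by (intro exI[of _ n]) linarith
    qed
    then have n1: "t < S (Suc n)" unfolding n_def by (rule LeastI_ex)
    then have "n \<noteq> 0" using t by (intro notI) simp
    then obtain j where j: "n = Suc j" using not0_implies_Suc by blast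
    have n2: "S n \<le> t"
      using not_less_Least[of j "\<lambda>n. t < S (Suc n)"] j unfolding n_def[symmetric] by simp
    define \<tau> where "\<tau> = t - S n"
    have \<tau>: "0 \<le> \<tau>" "\<tau> \<le> l n" "t = S n + \<tau>" using n1 n2 by (auto simp: \<tau>_def S_Suc)
    have "cost (p n) \<tau> \<le> \<tau> * C + 2 * B * e0 * t"
    proof (cases "t0 n \<le> \<tau>")
      case True
      have "0 \<le> 2 * B * e0 * t" using B_nonneg \<open>e0 > 0\<close> tpos by simp
      then show ?thesis using cost_pC[OF True \<tau>(2)] by linarith
    next
      case False
      have "cost (p n) \<tau> \<le> \<tau> * B" using cost_bound[OF xG pP \<tau>(1), of n] by linarith
      also have "\<dots> = \<tau> * C + \<tau> * (B - C)" by (simp add: algebra_simps)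
      also have "\<tau> * (B - C) \<le> \<tau> * (2 * B)" using BC \<tau>(1) by (intro mult_left_mono) auto
      also have "\<dots> \<le> (e0 * t) * (2 * B)"
      proof (rule mult_right_mono)
        have "\<tau> \<le> t0 n" using False by simp
        also have "\<dots> \<le> e0 * l j" using ln[of j] j by simp
        also have "\<dots> \<le> e0 * t" using n2 S_Suc[of j] S0[of j] j \<open>e0 > 0\<close> by (intro mult_left_mono) auto
        finally show "\<tau> \<le> e0 * t" .
      qed (use B_nonneg in simp)
      finally show ?thesis by (simp add: algebra_simps)
    qed
    then have "cost r t \<le> S n * C + \<tau> * C + 2 * B * e0 * t"
      using cost_split[OF \<tau>(1,2)] cost_S[of n] \<tau>(3) by simp
    also have "\<dots> = t * (Vstar z + (9 * e0 + 2 * B * e0))"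
      unfolding \<tau>(3) C_def by (simp add: algebra_simps)
    finally show ?thesis unfolding e0 .
  qed
  moreover have "S 1 > 0" using lpos[of 0] by (simp add: S_def)
  ultimately show ?thesis using rP by blast
qed

text \<open>After date \<open>m\<close> such a play still has long averages of at most about \<open>V\<^sup>*(z)\<close>, while its state at \<open>m\<close> does
not allow long averages below about \<open>V\<^sup>*(r m)\<close>.\<close>

lemma asymptotically_optimal_Vstar:
  assumes z: "z \<in> G" and r: "r \<in> P z" and cost_T: "\<And>t. t \<ge> T \<Longrightarrow> cost r t \<le> t * (Vstar z + e)" and m: "0 \<le> m" and "e > 0"
  shows "Vstar (r m) \<le> Vstar z + 3 * e"
proof -
  have rm: "r m \<in> G" "tail r m \<in> P (r m)" using play_tail[OF z r m] by auto
  obtain T' where "T' > 0" and T': "\<And>t z. t \<ge> T' \<Longrightarrow> z \<in> G \<Longrightarrow> \<bar>V 0 t z - Vstar z\<bar> \<le> e"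
    using V0_uniform_convergence[OF \<open>e > 0\<close>] by metis
  \<comment> \<open>What the first \<open>m\<close> units of time contribute; it is at most \<open>t e\<close> for the horizon chosen next.\<close>
  define K where "K = m * (2 * B + e)"
  define t where "t = max (max T T') (K / e)"
  have t: "t \<ge> T" "t \<ge> T'" "K / e \<le> t" "t > 0" using \<open>T' > 0\<close> by (auto simp: t_def)
  have "t * (Vstar (r m) - e) \<le> t * V 0 t (r m)"
    using T'[OF t(2) rm(1)] t by (intro mult_left_mono) auto
  also have "\<dots> \<le> cost (tail r m) t" using V_le[OF rm order_refl t(4)] by simp
  also have "\<dots> = cost r (m + t) - cost r m" using cost_shift[OF z r m, of t] t(4) by simp
  also have "cost r (m + t) \<le> (m + t) * (Vstar z + e)" using m t by (intro cost_T) simp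
  finally have "t * (Vstar (r m) - e) \<le> (m + t) * (Vstar z + e) - cost r m" by simp
  moreover have "- cost r m \<le> m * B" using cost_bound[OF z r m] by linarith
  moreover have "m * (Vstar z + e) \<le> m * (B + e)" using Vstar_bound[OF z] m by (intro mult_left_mono) auto
  ultimately have "t * (Vstar (r m) - e) \<le> t * (Vstar z + e) + K" by (simp add: K_def algebra_simps)
  moreover have "K \<le> t * e" using t(3) \<open>e > 0\<close> by (simp add: field_simps)
  ultimately have "t * Vstar (r m) \<le> t * (Vstar z + 3 * e)" by (simp add: algebra_simps)
  then show ?thesis using t(4) by simp
qed

lemma V_le_Vstar:
  assumes z: "z \<in> G" and "e > 0"
  obtains T where "T > 0" "\<And>t m. t \<ge> T \<Longrightarrow> m \<ge> 0 \<Longrightarrow> V m t z \<le> Vstar z + e"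
proof -
  define e' where "e' = e / 4"
  have "e' > 0" using \<open>e > 0\<close> by (simp add: e'_def)
  obtain r T0 where r: "r \<in> P z" "\<And>t. t \<ge> T0 \<Longrightarrow> cost r t \<le> t * (Vstar z + e')"
    using uniform_value[OF z \<open>e' > 0\<close>] by blast
  obtain T where "T > 0" and T: "\<And>t z. t \<ge> T \<Longrightarrow> z \<in> G \<Longrightarrow> \<bar>V 0 t z - Vstar z\<bar> \<le> e'"
    using V0_uniform_convergence[OF \<open>e' > 0\<close>] by metis
  show ?thesis
  proof (rule that[OF \<open>T > 0\<close>])
    fix t m assume t: "t \<ge> T" and m: "m \<ge> (0::real)"
    have "V m t z \<le> V 0 t (r m)"
      using V_after[OF z r(1) m order_refl, of t] t \<open>T > 0\<close> by simp
    moreover have "Vstar (r m) \<le> Vstar z + 3 * e'" by (rule asymptotically_optimal_Vstar[OF z r m \<open>e' > 0\<close>])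
    moreover have "\<bar>V 0 t (r m) - Vstar (r m)\<bar> \<le> e'" by (rule T[OF t play_in[OF z r(1) m]])
    moreover have "e = 4 * e'" by (simp add: e'_def)
    ultimately show "V m t z \<le> Vstar z + e" by linarith
  qed
qed

lemma Vstar_le_V:
  assumes z: "z \<in> G" and "e > 0"
  obtains T where "T > 0" "\<And>t. t \<ge> T \<Longrightarrow> Vstar z - e \<le> Vinf t z"
proof -
  have "e / 2 > 0" using \<open>e > 0\<close> by simp
  obtain T1 where "T1 > 0" and T1: "\<And>t z. t \<ge> T1 \<Longrightarrow> z \<in> G \<Longrightarrow> V 0 t z - e / 2 \<le> Vinf t z"
    using V0_le_Vstar[OF \<open>e / 2 > 0\<close>] by metis
  obtain T2 where T2: "\<And>t z. t \<ge> T2 \<Longrightarrow> z \<in> G \<Longrightarrow> \<bar>V 0 t z - Vstar z\<bar> \<le> e / 2"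
    using V0_uniform_convergence[OF \<open>e / 2 > 0\<close>] by metis
  show ?thesis
  proof (rule that[of "max T1 T2"])
    fix t assume "t \<ge> max T1 T2"
    then have "t \<ge> T1" "t \<ge> T2" by auto
    then show "Vstar z - e \<le> Vinf t z" using T1[OF _ z, of t] T2[OF _ z, of t] by linarith
  qed (use \<open>T1 > 0\<close> in simp)
qed

text \<open>The greedy argument without bound on the block lengths, along a play whose averages are eventually at most
\<open>V\<^sup>*(z) + e\<close>: expensive blocks from every date would produce arbitrarily long averages above
\<open>V\<^sup>*(z) + 2 e\<close>.\<close>

lemma late_start_cheap:
  assumes z: "z \<in> G" and "e > 0"
  obtains m where "m \<ge> 0" "\<And>t. t \<ge> 1 \<Longrightarrow> V m t z \<le> Vstar z + 2 * e"
proof -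
  obtain r T where r: "r \<in> P z" "T > 0" "\<And>t. t \<ge> T \<Longrightarrow> cost r t \<le> t * (Vstar z + e)"
    using uniform_value[OF z \<open>e > 0\<close>] by blast
  define c where "c = Vstar z + 2 * e"
  have "\<exists>m\<ge>0. \<forall>t\<ge>1. cost (tail r m) t \<le> t * c"
  proof (rule ccontr)
    assume neg: "\<not> (\<exists>m\<ge>0. \<forall>t\<ge>1. cost (tail r m) t \<le> t * c)"
    have "\<exists>m\<ge>real N. m * c \<le> cost r m" for N
    proof (induction N)
      case 0 show ?case by (intro exI[of _ 0]) (simp add: cost_def)
    next
      case (Suc N)
      then obtain m where m: "m \<ge> real N" "m * c \<le> cost r m" by blast
      then have "m \<ge> 0" by (meson of_nat_0_le_iff order_trans)
      then obtain t where t: "t \<ge> 1" "t * c < cost (tail r m) t" using neg by (meson not_le)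
      have "cost r (m + t) = cost r m + cost (tail r m) t" by (rule cost_shift[OF z r(1) \<open>m \<ge> 0\<close>]) (use t in simp)
      then have "(m + t) * c \<le> cost r (m + t)" using m(2) t(2) by (simp add: distrib_right)
      then show ?case using m t by (intro exI[of _ "m + t"]) auto
    qed
    moreover obtain N where "T \<le> real N" using real_arch_simple by blast
    ultimately obtain m where m: "m \<ge> T" "m * c \<le> cost r m" by (meson order_trans)
    then have "m * c \<le> m * (Vstar z + e)" using r(3)[of m] by linarith
    then show False using m(1) \<open>T > 0\<close> \<open>e > 0\<close> by (simp add: c_def)
  qed
  then obtain m where m: "m \<ge> 0" "\<And>t. t \<ge> 1 \<Longrightarrow> cost (tail r m) t \<le> t * c" by blast
  show ?thesis
  proof (rule that[OF m(1)])
    fix t :: real assume t: "t \<ge> 1"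
    then have "t * V m t z \<le> cost (tail r m) t" by (intro V_le[OF z r(1) m(1)]) simp
    also have "\<dots> \<le> t * c" by (rule m(2)[OF t])
    finally show "V m t z \<le> Vstar z + 2 * e" using t by (simp add: c_def)
  qed
qed

theorem V0_tendsto: "z \<in> G \<Longrightarrow> ((\<lambda>t. V 0 t z) \<longlongrightarrow> Vstar z) at_top"
  unfolding tendsto_iff
proof (intro allI impI)
  fix e :: real assume "z \<in> G" "e > 0"
  then obtain T where T: "\<And>t z. t \<ge> T \<Longrightarrow> z \<in> G \<Longrightarrow> \<bar>V 0 t z - Vstar z\<bar> \<le> e / 2"
    using V0_uniform_convergence[of "e / 2"] by (metis half_gt_zero)
  show "eventually (\<lambda>t. dist (V 0 t z) (Vstar z) < e) at_top"
    using eventually_ge_at_top[of T]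
    by eventually_elim (use T[OF _ \<open>z \<in> G\<close>] \<open>e > 0\<close> in \<open>fastforce simp: dist_real_def\<close>)
qed

theorem V0_uniform_limit: "uniform_limit G (\<lambda>t z. V 0 t z) Vstar at_top"
  unfolding uniform_limit_iff
proof (intro allI impI)
  fix e :: real assume "e > 0"
  then obtain T where T: "\<And>t z. t \<ge> T \<Longrightarrow> z \<in> G \<Longrightarrow> \<bar>V 0 t z - Vstar z\<bar> \<le> e / 2"
    using V0_uniform_convergence[of "e / 2"] by (metis half_gt_zero)
  show "eventually (\<lambda>t. \<forall>z\<in>G. dist (V 0 t z) (Vstar z) < e) at_top"
    using eventually_ge_at_top[of T]
    by eventually_elim (use T \<open>e > 0\<close> in \<open>fastforce simp: dist_real_def\<close>)
qed

theorem Vstar_eq_SUP_INF: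
  assumes z: "z \<in> G"
  shows "Vstar z = (SUP t\<in>{1..}. INF m\<in>{0..}. V m t z)"
  unfolding Vinf_def[symmetric]
proof (rule antisym)
  have bdd: "bdd_above ((\<lambda>t. Vinf t z) ` {1..})"
    using Vstar_ge[OF z] by (intro bdd_aboveI2[of _ _ "Vstar z"]) auto
  show "Vstar z \<le> (SUP t\<in>{1..}. Vinf t z)"
  proof (rule field_le_epsilon)
    fix e :: real assume "e > 0"
    then obtain T where T: "\<And>t. t \<ge> T \<Longrightarrow> Vstar z - e \<le> Vinf t z" using Vstar_le_V[OF z] by metis
    have "Vinf (max T 1) z \<le> (SUP t\<in>{1..}. Vinf t z)" by (rule cSUP_upper[OF _ bdd]) simp
    then show "Vstar z \<le> (SUP t\<in>{1..}. Vinf t z) + e" using T[of "max T 1"] by simp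
  qed
  show "(SUP t\<in>{1..}. Vinf t z) \<le> Vstar z" by (rule cSUP_least) (use Vstar_ge[OF z] in auto)
qed

text \<open>The inequality from above has to hold for all \<open>t \<ge> 1\<close> with a single \<open>m\<close>, so convergence alone does not
give it; this is what \<open>late_start_cheap\<close> is for.\<close>

theorem Vstar_eq_INF_SUP:
  assumes z: "z \<in> G"
  shows "Vstar z = (INF m\<in>{0..}. SUP t\<in>{1..}. V m t z)"
proof (rule antisym)
  have bdd: "bdd_above ((\<lambda>t. V m t z) ` {1..})" if "0 \<le> m" for m
    using abs_le_D1[OF V_bound[OF z that]] by (intro bdd_aboveI2[of _ _ B]) force
  have le: "Vstar z \<le> (SUP t\<in>{1..}. V m t z)" if "m \<ge> 0" for m
  proof -
    have "Vinf t z \<le> (SUP t\<in>{1..}. V m t z)" if "t \<ge> 1" for t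
      using Vinf_le[OF z _ \<open>m \<ge> 0\<close>, of t] cSUP_upper[OF _ bdd[OF \<open>m \<ge> 0\<close>], of t] that by simp
    then show ?thesis
      unfolding Vstar_eq_SUP_INF[OF z] Vinf_def[symmetric] by (intro cSUP_least) auto
  qed
  show "Vstar z \<le> (INF m\<in>{0..}. SUP t\<in>{1..}. V m t z)"
    by (rule cINF_greatest) (use le in auto)
  show "(INF m\<in>{0..}. SUP t\<in>{1..}. V m t z) \<le> Vstar z"
  proof (rule field_le_epsilon)
    fix e :: real assume "e > 0"
    then have "e / 2 > 0" by simp
    obtain m where m: "m \<ge> 0" "\<And>t. t \<ge> 1 \<Longrightarrow> V m t z \<le> Vstar z + 2 * (e / 2)"
      using late_start_cheap[OF z \<open>e / 2 > 0\<close>] by metis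
    have "(INF m\<in>{0..}. SUP t\<in>{1..}. V m t z) \<le> (SUP t\<in>{1..}. V m t z)"
      using m(1) le by (intro cINF_lower bdd_belowI2[of _ "Vstar z"]) auto
    also have "\<dots> \<le> Vstar z + e" by (rule cSUP_least) (use m(2) in auto)
    finally show "(INF m\<in>{0..}. SUP t\<in>{1..}. V m t z) \<le> Vstar z + e" .
  qed
qed

theorem V_tendsto_jointly:
  assumes z: "z \<in> G"
  shows "((\<lambda>(m, t). V m t z) \<longlongrightarrow> Vstar z) (at_top \<times>\<^sub>F at_top)"
  unfolding tendsto_iff
proof (intro allI impI)
  fix e :: real assume "e > 0"
  then have "e / 2 > 0" by simp
  obtain T1 where T1: "T1 > 0" "\<And>t m. t \<ge> T1 \<Longrightarrow> m \<ge> 0 \<Longrightarrow> V m t z \<le> Vstar z + e / 2"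
    using V_le_Vstar[OF z \<open>e / 2 > 0\<close>] by metis
  obtain T2 where T2: "\<And>t. t \<ge> T2 \<Longrightarrow> Vstar z - e / 2 \<le> Vinf t z" using Vstar_le_V[OF z \<open>e / 2 > 0\<close>] by metis
  show "eventually (\<lambda>x. dist (case x of (m, t) \<Rightarrow> V m t z) (Vstar z) < e) (at_top \<times>\<^sub>F at_top)"
    unfolding eventually_prod_filter
  proof (intro exI conjI allI impI)
    show "eventually (\<lambda>m::real. m \<ge> 0) at_top" by (rule eventually_ge_at_top)
    show "eventually (\<lambda>t::real. t \<ge> max T1 T2) at_top" by (rule eventually_ge_at_top)
    fix m t :: real assume mt: "m \<ge> 0" "t \<ge> max T1 T2"
    have "Vstar z - e / 2 \<le> V m t z" using T2[of t] Vinf_le[OF z _ mt(1), of t] mt(2) T1(1) by simp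
    then show "dist (case (m, t) of (m, t) \<Rightarrow> V m t z) (Vstar z) < e"
      using T1(2)[of t m] mt \<open>e > 0\<close> by (simp add: dist_real_def)
  qed
qed

end

section \<open>The control problem as a nonexpansive family of plays\<close>

context control_system
begin

lemma reachable_eq:
  "reachable g z = {p t | p t. 0 \<le> t \<and> (\<exists>u\<in>controls. integral_solution g u z p)}" (is "_ = ?R")
proof (intro equalityI subsetI)
  fix x assume "x \<in> reachable g z"
  then obtain t u where x: "x = traj g t u z" "0 \<le> t" "u \<in> controls" by (auto simp: reachable_def)
  moreover obtain p where "integral_solution g u z p" using integral_solution_exists[OF x(3)] by blast
  ultimately show "x \<in> ?R" using traj_eq_integral_solution by blast
next
  fix x assume "x \<in> ?R"
  then obtain p t u where "x = p t" "0 \<le> t" "u \<in> controls" "integral_solution g u z p" by blast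
  then have "x = traj g t u z" using traj_eq_integral_solution by simp
  then show "x \<in> reachable g z" using \<open>0 \<le> t\<close> \<open>u \<in> controls\<close> unfolding reachable_def by blast
qed

lemma reachable_start: "z \<in> reachable g z"
proof -
  obtain p where p: "integral_solution g (\<lambda>_. undefined) z p"
    using integral_solution_exists[OF controls_const] by blast
  then have "z = p 0" using integral_solution_start by metis
  then show ?thesis using p controls_const unfolding reachable_eq by blast
qed

text \<open>A reachable state followed by a trajectory is a concatenation. Later blocks have length \<open>t + 1\<close>, so that
the date \<open>t\<close> of the second trajectory falls inside its first block.\<close>

lemma reachable_invariant:
  assumes x: "x \<in> reachable g z" and u: "u \<in> controls" and p: "integral_solution g u x p" and t: "0 \<le> t"
  shows "p t \<in> reachable g z"
proof -
  obtain w q s where q: "w \<in> controls" "integral_solution g w z q" and s: "0 \<le> s" "x = q s"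
    using x unfolding reachable_eq by blast
  show ?thesis
  proof (cases "s = 0")
    case True
    then have "x = z" using s integral_solution_start[OF q(2)] by simp
    then show ?thesis using u p t unfolding reachable_eq by blast
  next
    case False
    define l where "l n = (if n = 0 then s else t + 1)" for n :: nat
    define us where "us n = (if n = 0 then w else (\<lambda>r. u (real (n - 1) * (t + 1) + r)))" for n
    define xs where "xs n = (if n = 0 then z else p (real (n - 1) * (t + 1)))" for n
    define ps where "ps n = (if n = 0 then q else (\<lambda>r. p (real (n - 1) * (t + 1) + r)))" for n
    have S: "(\<Sum>i<Suc n. l i) = s + real n * (t + 1)" for n
      by (induction n) (auto simp: l_def algebra_simps)
    have lpos: "0 < l n" for n using False s t by (simp add: l_def)
    have unb: "\<exists>n. c < (\<Sum>i<n. l i)" for c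
    proof -
      obtain n where n: "c < real n" using reals_Archimedean2 by blast
      have "real n \<le> real n * (t + 1)" using t by (simp add: mult_le_cancel_left1)
      then show ?thesis using n S[of n] s by (intro exI[of _ "Suc n"]) linarith
    qed
    have "us n \<in> controls" for n
      using q(1) controls_shift[OF u] t by (simp add: us_def)
    moreover have "integral_solution g (us n) (xs n) (ps n)" for n
      using q(2) integral_solution_shift[OF p] t by (simp add: us_def xs_def ps_def)
    moreover have "ps n (l n) = xs (Suc n)" for n
      using s integral_solution_start[OF p] by (cases n) (simp_all add: ps_def l_def xs_def algebra_simps)
    ultimately obtain v r where v: "v \<in> controls" "integral_solution g v (xs 0) r"
      "\<And>n t. 0 \<le> t \<Longrightarrow> t \<le> l n \<Longrightarrow> r ((\<Sum>i<n. l i) + t) = ps n t"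
      using integral_solution_concat[of l us xs ps, OF lpos unb] by blast
    have "r (s + t) = p t"
      using v(3)[of t 1] t by (simp add: l_def ps_def)
    then show ?thesis
      using v(1,2) s t unfolding reachable_eq xs_def by (auto intro!: exI[of _ r] exI[of _ "s + t"])
  qed
qed

text \<open>Write \<open>b z v = \<langle>x - y, g(z, v)\<rangle>\<close>. The hypothesis becomes \<open>b x u \<le> s\<close> for all \<open>u\<close>, where
\<open>s = sup\<^sub>v b y v\<close>, and any \<open>v\<close> with \<open>b y v > s - e\<close> works for every \<open>u\<close> simultaneously.\<close>

lemma dissipativity_decoupled:
  assumes diss: "(SUP u. INF v. (x - y) \<bullet> (g (x, u) - g (y, v))) \<le> 0" and "e > 0"
  shows "\<exists>v. \<forall>u. (x - y) \<bullet> (g (x, u) - g (y, v)) \<le> e"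
proof -
  define b where "b z v = (x - y) \<bullet> g (z, v)" for z v
  have bb: "\<bar>b z v\<bar> \<le> norm (x - y) * (a * (1 + norm z))" for z v
    unfolding b_def using Cauchy_Schwarz_ineq2[of "x - y" "g (z, v)"] g_growth[of z v]
    by (meson mult_left_mono norm_ge_zero order_trans)
  define C where "C z = norm (x - y) * (a * (1 + norm z))" for z :: 'a
  have bup: "b z v \<le> C z" and blo: "- C z \<le> b z v" for z v
    using bb[of z v] by (auto simp: C_def)
  define s where "s = (SUP v. b y v)"
  have bdd: "bdd_above (range (b y))" using bup by (intro bdd_aboveI2[of _ _ "C y"])
  have bs: "b y v \<le> s" for v unfolding s_def by (rule cSUP_upper[OF _ bdd]) simp
  obtain v where v: "s - e < b y v"
    using less_cSUP_iff[OF _ bdd, of "s - e"] \<open>e > 0\<close> by (auto simp: s_def)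
  have eq: "(x - y) \<bullet> (g (x, u) - g (y, v)) = b x u - b y v" for u v
    by (simp add: b_def inner_diff_right)
  have "b x u \<le> s" for u
  proof -
    have lower: "b x u - s \<le> (INF v. b x u - b y v)" for u
      by (rule cINF_greatest) (use bs in auto)
    have "(INF v. b x u - b y v) \<le> (SUP u. INF v. b x u - b y v)"
    proof (rule cSUP_upper)
      have bdd': "bdd_below (range (\<lambda>v. b x u - b y v))" for u
        using bs by (intro bdd_belowI2[of _ "b x u - s"]) simp
      have "(INF v. b x u - b y v) \<le> C x + C y" for u
        using cINF_lower[OF bdd'[of u] UNIV_I, of undefined] bup[of x u] blo[of y undefined] by linarith
      then show "bdd_above (range (\<lambda>u. INF v. b x u - b y v))" by (intro bdd_aboveI2)
    qed simp
    then show ?thesis using lower[of u] diss unfolding eq by linarith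
  qed
  then show ?thesis using v unfolding eq by (intro exI[of _ v]) (smt (verit))
qed

end

lemma bounded_finite_net:
  fixes G :: "'a::heine_borel set"
  assumes "bounded G" "e > 0"
  shows "\<exists>F. finite F \<and> F \<subseteq> G \<and> G \<subseteq> (\<Union>f\<in>F. ball f e)"
proof -
  have comp: "compact (closure G)" using assms(1) by (simp add: compact_closure)
  have cov: "closure G \<subseteq> (\<Union>f\<in>G. ball f e)"
    using assms(2) by (auto simp: closure_approachable)
  obtain F where "F \<subseteq> G" "finite F" "closure G \<subseteq> (\<Union>f\<in>F. ball f e)"
    by (rule compactE_image[OF comp open_ball cov])
  then show ?thesis using closure_subset[of G] by blast
qed

lemma bounded_uniformly_continuous:
  fixes k :: "'a::heine_borel \<Rightarrow> real"
  assumes "continuous_on UNIV k" "bounded G"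
  shows "uniformly_continuous_on G k"
proof -
  have "uniformly_continuous_on (closure G) k"
    using assms by (intro compact_uniformly_continuous continuous_on_subset[OF assms(1)]) (auto simp: compact_closure)
  then show ?thesis
    using closure_subset[of G] unfolding uniformly_continuous_on_def by (meson subsetD)
qed

theorem proposition3p3:
  fixes g :: "(real ^ 'd) \<times> 'u::metric_space \<Rightarrow> real ^ 'd"
    and h :: "(real ^ 'd) \<times> 'u \<Rightarrow> real"
    and L a :: real
    and y0 :: "real ^ 'd"
  assumes "g \<in> borel_measurable borel"
    and "L \<ge> 0"
    and "\<And>y y' u. norm (g (y, u) - g (y', u)) \<le> L * norm (y - y')"
    and "a > 0"
    and "\<And>y u. norm (g (y, u)) \<le> a * (1 + norm y)"
    and "h \<in> borel_measurable borel"
    and "bounded (range h)"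
    and "\<exists>k. continuous_on UNIV k \<and> (\<forall>y u. h (y, u) = k y)"
    and "bounded (reachable g y0)"
    and "\<And>y1 y2. y1 \<in> reachable g y0 \<Longrightarrow> y2 \<in> reachable g y0 \<Longrightarrow>
           (SUP u. INF v. (y1 - y2) \<bullet> (g (y1, u) - g (y2, v))) \<le> 0"
  shows "has_limit_value g h y0 (val_star g h y0)
    \<and> uniform_limit (reachable g y0) (\<lambda>t z. val g h 0 t z) (val_star g h) at_top
    \<and> val_star g h y0 = (SUP t\<in>{1..}. INF m\<in>{0..}. val g h m t y0)
    \<and> val_star g h y0 = (INF m\<in>{0..}. SUP t\<in>{1..}. val g h m t y0)
    \<and> ((\<lambda>(m, t). val g h m t y0) \<longlongrightarrow> val_star g h y0) (at_top \<times>\<^sub>F at_top)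
    \<and> has_uniform_value g h y0"
proof -
  interpret control_system g L a
    by unfold_locales (use assms in auto)
  define G where "G = reachable g y0"
  define P where "P z = {p. \<exists>u\<in>controls. integral_solution g u z p}" for z
  obtain k where k: "continuous_on UNIV k" "\<And>y u. h (y, u) = k y" using assms(8) by blast
  obtain B where B: "\<And>x. \<bar>h x\<bar> \<le> B"
    using assms(7) unfolding bounded_iff by auto
  have kB: "\<bar>k y\<bar> \<le> B" for y using B[of "(y, undefined)"] k(2) by simp
  obtain R where R: "\<And>z. z \<in> G \<Longrightarrow> norm z \<le> R"
    using assms(9) unfolding G_def bounded_iff by blast
  have inv: "p t \<in> G" if "z \<in> G" "u \<in> controls" "integral_solution g u z p" "t \<ge> 0" for z u p t
    using reachable_invariant that unfolding G_def by blast
  interpret N: nonexpansive_plays G P k B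
  proof
    show "\<exists>F. finite F \<and> F \<subseteq> G \<and> G \<subseteq> (\<Union>f\<in>F. ball f e)" if "e > 0" for e
      by (rule bounded_finite_net[OF _ that]) (use assms(9) in \<open>simp add: G_def\<close>)
    show "\<bar>k z\<bar> \<le> B" for z by (rule kB)
    show "uniformly_continuous_on G k"
      by (rule bounded_uniformly_continuous[OF k(1)]) (use assms(9) in \<open>simp add: G_def\<close>)
    show "0 \<le> B" using kB[of undefined] by linarith
    show "P z \<noteq> {}" for z
    proof -
      obtain p where "integral_solution g (\<lambda>_. undefined) z p"
        using integral_solution_exists[OF controls_const] by blast
      then show ?thesis using controls_const unfolding P_def by blast
    qed
    show "p 0 = z" if "p \<in> P z" for p z using that integral_solution_start by (auto simp: P_def)
    show "p t \<in> G" if "z \<in> G" "p \<in> P z" "0 \<le> t" for z p t using that inv by (auto simp: P_def)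
    show "continuous_on {0..} p" if "p \<in> P z" for p z using that integral_solution_continuous by (auto simp: P_def)
    show "(\<lambda>t. p (s + t)) \<in> P (p s)" if "p \<in> P z" "0 \<le> s" for p z s
      using that integral_solution_shift controls_shift unfolding P_def by blast
    show "\<exists>r\<in>P (x 0). \<forall>n. \<forall>t\<in>{0..l n}. r ((\<Sum>i<n. l i) + t) = q n t"
      if lpos: "\<And>n. 0 < l n" and unb: "\<And>c. \<exists>n. c < (\<Sum>i<n. l i)" and qP: "\<And>n. q n \<in> P (x n)"
        and join: "\<And>n. q n (l n) = x (Suc n)"
      for l :: "nat \<Rightarrow> real" and x q
    proof -
      have "\<forall>n. \<exists>u. u \<in> controls \<and> integral_solution g u (x n) (q n)"
        using qP by (auto simp: P_def)
      from choice[OF this] obtain u where u: "\<And>n. u n \<in> controls" "\<And>n. integral_solution g (u n) (x n) (q n)"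
        by blast
      obtain v r where "v \<in> controls" "integral_solution g v (x 0) r"
        "\<And>n t. 0 \<le> t \<Longrightarrow> t \<le> l n \<Longrightarrow> r ((\<Sum>i<n. l i) + t) = q n t"
        using integral_solution_concat[of l u x q, OF lpos unb u join] by blast
      then show ?thesis by (auto simp: P_def)
    qed
    show "\<exists>q\<in>P z'. \<forall>t\<ge>0. dist (p t) (q t) \<le> dist z z' + e"
      if zG: "z \<in> G" "z' \<in> G" and p: "p \<in> P z" and e: "e > 0" for z z' p e
    proof -
      obtain u where u: "u \<in> controls" "integral_solution g u z p" using p by (auto simp: P_def)
      have "\<exists>v\<in>controls. \<exists>q. integral_solution g v z' q \<and> (\<forall>t\<ge>0. dist (p t) (q t) \<le> dist z z' + e)"
      proof (rule nonexpansive_response[of G R])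
        show "\<exists>v. \<forall>w. (x - y) \<bullet> (g (x, w) - g (y, v)) \<le> e" if "x \<in> G" "y \<in> G" "e > 0" for x y e
          using assms(10) that unfolding G_def by (intro dissipativity_decoupled) auto
      qed (use inv R zG e u in auto)
      then show ?thesis by (auto simp: P_def)
    qed
  qed
  have avg: "avg_cost g h m t z u = N.cost (\<lambda>s. p (m + s)) t / t"
    if z: "z \<in> G" and u: "u \<in> controls" and p: "integral_solution g u z p" and m: "0 \<le> m" and t: "0 < t" for m t z u p
  proof -
    have cont: "continuous_on {m..m + t} (\<lambda>s. k (p s))"
      by (rule continuous_on_compose2[OF k(1)])
        (use integral_solution_continuous[OF p] m in \<open>auto intro: continuous_on_subset\<close>)
    have "(LINT s:{m..m + t}|lebesgue. h (traj g s u z, u s)) = (LINT s:{m..m + t}|lebesgue. k (p s))"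
      by (rule set_lebesgue_integral_cong) (use m traj_eq_integral_solution[OF p] k(2) in auto)
    also have "\<dots> = integral {m..m + t} (\<lambda>s. k (p s))"
      by (rule set_lebesgue_integral_eq_integral(2)[OF absolutely_integrable_continuous_real[OF cont]])
    also have "\<dots> = N.cost (\<lambda>s. p (m + s)) t"
    proof -
      have "((\<lambda>s. k (p s)) has_integral integral {m..m + t} (\<lambda>s. k (p s))) {m + 0..m + t}"
        using integrable_continuous_interval[OF cont] by (simp add: integrable_integral)
      then have "((\<lambda>s. k (p (m + s))) has_integral integral {m..m + t} (\<lambda>s. k (p s))) {0..t}"
        by (simp only: has_integral_translate[of "\<lambda>s. k (p s)"])
      then show ?thesis unfolding N.cost_def by (rule integral_unique[symmetric])
    qed
    finally show ?thesis unfolding avg_cost_def by simp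
  qed
  have val: "val g h m t z = N.V m t z" if "z \<in> G" "0 \<le> m" "0 < t" for m t z
  proof -
    have "(\<lambda>u. avg_cost g h m t z u) ` controls = (\<lambda>p. N.cost (\<lambda>s. p (m + s)) t / t) ` P z"
    proof (intro equalityI subsetI)
      fix c assume "c \<in> (\<lambda>u. avg_cost g h m t z u) ` controls"
      then obtain u where u: "u \<in> controls" "c = avg_cost g h m t z u" by blast
      obtain p where "integral_solution g u z p" using integral_solution_exists[OF u(1)] by blast
      then show "c \<in> (\<lambda>p. N.cost (\<lambda>s. p (m + s)) t / t) ` P z"
        using avg[OF that(1) u(1) _ that(2,3)] u by (auto simp: P_def)
    next
      fix c assume "c \<in> (\<lambda>p. N.cost (\<lambda>s. p (m + s)) t / t) ` P z"
      then obtain p u where "u \<in> controls" "integral_solution g u z p" "c = N.cost (\<lambda>s. p (m + s)) t / t"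
        by (auto simp: P_def)
      then show "c \<in> (\<lambda>u. avg_cost g h m t z u) ` controls"
        using avg[OF that(1) _ _ that(2,3)] by force
    qed
    then show ?thesis unfolding val_def N.V_def by simp
  qed
  have star: "val_star g h z = N.Vstar z" if z: "z \<in> G" for z
    unfolding val_star_def N.Vstar_def N.Vinf_def
    by (intro SUP_cong INF_cong refl) (use val[OF z] in auto)
  have y0: "y0 \<in> G" unfolding G_def by (rule reachable_start)
  have ev: "eventually (\<lambda>t. val g h 0 t z = N.V 0 t z) at_top" if "z \<in> G" for z
    using eventually_gt_at_top[of 0] by eventually_elim (rule val[OF that order_refl])
  have 1: "has_limit_value g h y0 (val_star g h y0)"
    unfolding has_limit_value_def star[OF y0] tendsto_cong[OF ev[OF y0]]
    by (rule N.V0_tendsto[OF y0])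
  have 2: "uniform_limit (reachable g y0) (\<lambda>t z. val g h 0 t z) (val_star g h) at_top"
  proof -
    have "eventually (\<lambda>t. \<forall>z\<in>G. val g h 0 t z = N.V 0 t z) at_top"
      using eventually_gt_at_top[of 0] by eventually_elim (use val in auto)
    from uniform_limit_cong[OF this star] show ?thesis
      using N.V0_uniform_limit unfolding G_def[symmetric] by simp
  qed
  have 3: "val_star g h y0 = (SUP t\<in>{1..}. INF m\<in>{0..}. val g h m t y0)"
    unfolding star[OF y0] N.Vstar_eq_SUP_INF[OF y0]
    by (intro SUP_cong INF_cong refl) (use val[OF y0] in auto)
  have 4: "val_star g h y0 = (INF m\<in>{0..}. SUP t\<in>{1..}. val g h m t y0)"
    unfolding star[OF y0] N.Vstar_eq_INF_SUP[OF y0]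
    by (intro SUP_cong INF_cong refl) (use val[OF y0] in auto)
  have 5: "((\<lambda>(m, t). val g h m t y0) \<longlongrightarrow> val_star g h y0) (at_top \<times>\<^sub>F at_top)"
  proof -
    have "eventually (\<lambda>x. (case x of (m, t) \<Rightarrow> N.V m t y0) = (case x of (m, t) \<Rightarrow> val g h m t y0)) (at_top \<times>\<^sub>F at_top)"
      unfolding eventually_prod_filter
      by (intro exI conjI allI impI, rule eventually_ge_at_top[of 0], rule eventually_gt_at_top[of 0])
        (use val[OF y0] in auto)
    then show ?thesis
      unfolding star[OF y0] using N.V_tendsto_jointly[OF y0] Lim_transform_eventually by blast
  qed
  have 6: "has_uniform_value g h y0"
    unfolding has_uniform_value_def
  proof (intro exI conjI allI impI)
    show "has_limit_value g h y0 (val_star g h y0)" by (rule 1)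
    fix e :: real assume "e > 0"
    obtain r T where r: "r \<in> P y0" "T > 0" "\<And>t. t \<ge> T \<Longrightarrow> N.cost r t \<le> t * (N.Vstar y0 + e)"
      using N.uniform_value[OF y0 \<open>e > 0\<close>] by blast
    obtain u where u: "u \<in> controls" "integral_solution g u y0 r" using r(1) by (auto simp: P_def)
    have "avg_cost g h 0 t y0 u \<le> val_star g h y0 + e" if "t \<ge> T" for t
    proof -
      have t: "0 < t" using r(2) that by linarith
      have "avg_cost g h 0 t y0 u = N.cost r t / t" using avg[OF y0 u order_refl t] by simp
      also have "\<dots> \<le> t * (N.Vstar y0 + e) / t" using r(3)[OF that] t by (intro divide_right_mono) auto
      also have "\<dots> = val_star g h y0 + e" using t star[OF y0] by simp
      finally show ?thesis .
    qed
    then show "\<exists>u\<in>controls. \<exists>t0>0. \<forall>t\<ge>t0. avg_cost g h 0 t y0 u \<le> val_star g h y0 + e"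
      using u(1) r(2) by blast
  qed
  show ?thesis using 1 2 3 4 5 6 by blast
qed

end
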